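(* Assume A1, A2, A3, A4 and A5 (stated in the context). Then for any strictly increasing $\alpha:\mathbb{N}\to\mathbb{R}_{>0}$, any $\nu\in\mathbb{N}$ and any $\epsilon>0$, the $\nu$-BIC $$\hat k_n^{\nu}=\min\ \underset{k\in[\bar k]}{\arg\min}\Big\{\min_{\psi_k\in\mathbb{S}_k}\ell_{k,n}(\psi_k)+\alpha(k)\frac{\mathrm{Ln}^{\circ\nu}(n)\log n}{n}\Big\}$$ and the $\epsilon$-BIC $$\hat k_n^{\epsilon}=\min\ \underset{k\in[\bar k]}{\arg\min}\Big\{\min_{\psi_k\in\mathbb{S}_k}\ell_{k,n}(\psi_k)+\alpha(k)\frac{(\log n)^{1+\epsilon}}{n}\Big\}$$ are consistent estimators of $k_0$, i.e. $\lim_{n\to\infty}\mathrm{P}(\hat k_n^{\nu}=k_0)=1$ and $\lim_{n\to\infty}\mathrm{P}(\hat k_n^{\epsilon}=k_0)=1$.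
   Context: Setting. $(\Omega,\mathcal{A},\mathrm{P})$ is a probability space with expectation $\mathrm{E}$; $X:\Omega\to\mathbb{X}$ is a random map with density $f_0:\mathbb{X}\to\mathbb{R}_{>0}$ with respect to a measure $\mathfrak{m}$ on $(\mathbb{X},\mathcal{B}(\mathbb{X}))$; $P$ denotes the law of $X$. $\mathbb{T}\subset\mathbb{R}^m$ and $\phi:\mathbb{X}\times\mathbb{T}\to\mathbb{R}_{>0}$ satisfies $\int_{\mathbb{X}}\phi(x;\theta)\,\mathfrak{m}(\mathrm{d}x)=1$ for each $\theta\in\mathbb{T}$. Write $[k]=\{1,\dots,k\}$. For $k\in\mathbb{N}$, $$\mathcal{M}_k^\phi=\Big\{x\mapsto f_k(x;\psi_k)=\sum_{z=1}^k\pi_z\phi(x;\theta_z):\ \theta_z\in\mathbb{T},\ \pi_z\in[0,1],\ \sum_{z=1}^k\pi_z=1\Big\},\qquad \mathcal{M}_0^\phi=\varnothing,$$ where $\psi_k=(\pi_1,\dots,\pi_k,\theta_1,\dots,\theta_k)$ ranges over $\mathbb{S}_k=\{(\pi_1,\dots,\pi_k)\in[0,1]^k:\sum_z\pi_z=1\}\times\mathbb{T}^k$. $\bar k\in\mathbb{N}$ is fixed. Densities are identified when they agree $\mathfrak{m}$-almost everywhere. For a sample $X_1,\dots,X_n$, put $\ell_{k,n}(\psi_k)=-n^{-1}\sum_{i=1}^n\log f_k(X_i;\psi_k)$. $\mathrm{Ln}(n)=\log(\max\{e,n\})$, and $\mathrm{Ln}^{\circ\nu}$ is its $\nu$-fold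 composition. All random quantities of interest are assumed measurable. A1: $f_0\in\mathcal{M}_{k_0}^\phi\setminus\mathcal{M}_{k_0-1}^\phi$ for some $k_0\in[\bar k]$, and $X_1,\dots,X_n$ are IID replicates of $X$. A2: $\phi(x;\theta)>0$ for each $x\in\mathbb{X}$, $\theta\in\mathbb{T}$, and $\mathbb{T}\subset\mathbb{R}^m$ is compact. A3: $\phi(x;\cdot):\mathbb{T}\to\mathbb{R}$ is continuous for each fixed $x$, and $\phi(\cdot;\theta):\mathbb{X}\to\mathbb{R}$ is measurable for each fixed $\theta$. A4: there is $G_1\in\mathcal{L}_1(P)$ with $\max_{\theta\in\mathbb{T}}|\log\phi(x;\theta)|<G_1(x)$ for every $x\in\mathbb{X}$. A5: there are $L_\phi:\mathbb{X}\to\mathbb{R}_{\ge0}$ and $G_2\in\mathcal{L}_1(\mathfrak{m})$ such that for all $\theta_1,\theta_2\in\mathbb{T}$ and $x\in\mathbb{X}$, $|\phi(x;\theta_1)-\phi(x;\theta_2)|\le L_\phi(x)\|\theta_1-\theta_2\|_1$, and $\max_{\theta\in\mathbb{T}}\phi(x;\theta)+L_\phi(x)\le G_2(x)$. *)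

theory Defs
  imports "HOL-Probability.Probability"
begin

definition mixture_params :: "'t set \<Rightarrow> nat \<Rightarrow> ((nat \<Rightarrow> real) \<times> (nat \<Rightarrow> 't)) set" where
  "mixture_params T k =
     {\<pi> \<in> {1..k} \<rightarrow>\<^sub>E {0..1}. (\<Sum>z=1..k. \<pi> z) = 1} \<times> ({1..k} \<rightarrow>\<^sub>E T)"

definition mixture ::
  "('x \<Rightarrow> 't \<Rightarrow> real) \<Rightarrow> nat \<Rightarrow> (nat \<Rightarrow> real) \<times> (nat \<Rightarrow> 't) \<Rightarrow> 'x \<Rightarrow> real" where
  "mixture \<phi> k \<psi> x = (\<Sum>z=1..k. fst \<psi> z * \<phi> x (snd \<psi> z))"

text \<open>The class of k-component mixtures, closed under equality \<open>\<mu>\<close>-almost everywhere because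
  densities are identified up to null sets.\<close>

definition mixture_class ::
  "'x measure \<Rightarrow> 't set \<Rightarrow> ('x \<Rightarrow> 't \<Rightarrow> real) \<Rightarrow> nat \<Rightarrow> ('x \<Rightarrow> real) set" where
  "mixture_class \<mu> T \<phi> k =
     {f. \<exists>\<psi> \<in> mixture_params T k. AE x in \<mu>. f x = mixture \<phi> k \<psi> x}"

lemma mixture_class_0: "mixture_class \<mu> T \<phi> 0 = {}"
  by (simp add: mixture_class_def mixture_params_def)

definition neg_loglik ::
  "('x \<Rightarrow> 't \<Rightarrow> real) \<Rightarrow> nat \<Rightarrow> nat \<Rightarrow> (nat \<Rightarrow> 'x) \<Rightarrow> (nat \<Rightarrow> real) \<times> (nat \<Rightarrow> 't) \<Rightarrow> real" where
  "neg_loglik \<phi> k n xs \<psi> = - (1 / real n) * (\<Sum>i=1..n. ln (mixture \<phi> k \<psi> (xs i)))"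

text \<open>The least element of the set of values, as opposed to its infimum. It exists when \<open>T\<close> is
  compact and nonempty, \<open>k \<ge> 1\<close>, and \<open>\<phi> x\<close> is positive and continuous on \<open>T\<close>.\<close>

definition min_neg_loglik ::
  "'t set \<Rightarrow> ('x \<Rightarrow> 't \<Rightarrow> real) \<Rightarrow> nat \<Rightarrow> nat \<Rightarrow> (nat \<Rightarrow> 'x) \<Rightarrow> real" where
  "min_neg_loglik T \<phi> k n xs = (LEAST v. v \<in> neg_loglik \<phi> k n xs ` mixture_params T k)"

definition order_estimator ::
  "'t set \<Rightarrow> ('x \<Rightarrow> 't \<Rightarrow> real) \<Rightarrow> nat \<Rightarrow> (nat \<Rightarrow> real) \<Rightarrow> nat \<Rightarrow> (nat \<Rightarrow> 'x) \<Rightarrow> nat" where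
  "order_estimator T \<phi> K pen n xs =
     Min {k. is_arg_min (\<lambda>k. min_neg_loglik T \<phi> k n xs + pen k) (\<lambda>k. k \<in> {1..K}) k}"

definition Ln :: "real \<Rightarrow> real" where
  "Ln x = ln (max (exp 1) x)"

definition nu_BIC ::
  "'t set \<Rightarrow> ('x \<Rightarrow> 't \<Rightarrow> real) \<Rightarrow> nat \<Rightarrow> (nat \<Rightarrow> real) \<Rightarrow> nat \<Rightarrow> nat \<Rightarrow> (nat \<Rightarrow> 'x) \<Rightarrow> nat" where
  "nu_BIC T \<phi> K \<alpha> \<nu> n =
     order_estimator T \<phi> K (\<lambda>k. \<alpha> k * ((Ln ^^ \<nu>) (real n) * ln (real n) / real n)) n"

definition eps_BIC ::
  "'t set \<Rightarrow> ('x \<Rightarrow> 't \<Rightarrow> real) \<Rightarrow> nat \<Rightarrow> (nat \<Rightarrow> real) \<Rightarrow> real \<Rightarrow> nat \<Rightarrow> (nat \<Rightarrow> 'x) \<Rightarrow> nat" where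
  "eps_BIC T \<phi> K \<alpha> \<epsilon> n =
     order_estimator T \<phi> K (\<lambda>k. \<alpha> k * (ln (real n) powr (1 + \<epsilon>) / real n)) n"

end

theory Submission
  imports Defs "HOL-Real_Asymp.Real_Asymp"
begin

text \<open>
  No law of large numbers is needed, only Markov's inequality applied to products of likelihood
  ratios. Enlarging a mixture density by \<open>\<delta> (k + 1) G\<^sub>2\<close> gives an upper bracket \<open>u\<close> for all
  mixtures whose parameters are \<open>\<delta>\<close>-close to it.

  Overfitting (\<open>k > k\<^sub>0\<close>): with \<open>\<delta> = 1 / n\<close> polynomially many brackets suffice, and
  \<open>\<Prod>\<^sub>i u(X\<^sub>i) / f\<^sub>0(X\<^sub>i)\<close> has expectation \<open>(\<integral> u)\<^sup>n \<le> (1 + \<gamma> / n)\<^sup>n \<le> exp \<gamma>\<close>. Hence with probability tending to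
  1 the maximal log-likelihood ratio is at most a multiple of \<open>log n\<close>, which any penalty of larger
  order beats.

  Underfitting (\<open>k < k\<^sub>0\<close>): the affinity \<open>\<integral> sqrt(f f\<^sub>0)\<close> is below 1 for every \<open>f\<close> in the smaller class, and
  it stays below 1 for brackets with small \<open>\<delta>\<close>. By compactness finitely many of them cover the class, so
  \<open>\<Prod>\<^sub>i sqrt(u(X\<^sub>i) / f\<^sub>0(X\<^sub>i))\<close> is exponentially small and the likelihood ratio deficit is linear in \<open>n\<close>.
\<close>

section \<open>Finite nets of polynomial size in the parameter space\<close>

text \<open>Picking one point from each fibre of \<open>h\<close> turns a bound on the number of
  values of a discretisation into a bound on the size of a net that lies inside \<open>A\<close>
  itself.\<close>

lemma ex_transversal:
  assumes "finite (h ` A)"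
  obtains S where "S \<subseteq> A" "finite S" "card S \<le> card (h ` A)" "\<And>a. a \<in> A \<Longrightarrow> \<exists>s\<in>S. h s = h a"
proof
  let ?S = "inv_into A h ` h ` A"
  show "?S \<subseteq> A" by (auto intro: inv_into_into)
  show "finite ?S" using assms by simp
  show "card ?S \<le> card (h ` A)" by (rule card_image_le[OF assms])
  show "\<exists>s\<in>?S. h s = h a" if "a \<in> A" for a
    using that f_inv_into_f[of "h a" h A] by blast
qed

text \<open>Weights are compared in absolute value and atoms in the l1 norm, which is the norm of
  the Lipschitz condition on \<open>\<phi>\<close>. Only the indices from 1 to \<open>k\<close>
  count, since the extensional functions are \<open>undefined\<close> elsewhere.\<close>

definition close_params ::
  "nat \<Rightarrow> real \<Rightarrow> (nat \<Rightarrow> real) \<times> (nat \<Rightarrow> real ^ 'm) \<Rightarrow> (nat \<Rightarrow> real) \<times> (nat \<Rightarrow> real ^ 'm) \<Rightarrow> bool" where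
  "close_params k \<delta> \<psi> \<psi>' \<longleftrightarrow>
     (\<forall>z\<in>{1..k}. \<bar>fst \<psi> z - fst \<psi>' z\<bar> \<le> \<delta> \<and>
        (\<Sum>j\<in>UNIV. \<bar>(snd \<psi> z - snd \<psi>' z) $ j\<bar>) \<le> \<delta>)"

lemma mixture_params_D:
  assumes "\<psi> \<in> mixture_params T k"
  shows "z \<in> {1..k} \<Longrightarrow> fst \<psi> z \<in> {0..1}" "z \<in> {1..k} \<Longrightarrow> snd \<psi> z \<in> T"
    "(\<Sum>z=1..k. fst \<psi> z) = 1"
  using assms by (auto simp: mixture_params_def PiE_iff)

lemma abs_diff_le_of_floor_eq:
  fixes x y c :: real
  assumes "c > 0" "\<lfloor>c * x\<rfloor> = \<lfloor>c * y\<rfloor>"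
  shows "\<bar>x - y\<bar> \<le> 1 / c"
proof -
  have "\<bar>c * x - c * y\<bar> \<le> 1"
    using assms(2) by linarith
  then have "c * \<bar>x - y\<bar> \<le> 1"
    using assms(1) by (metis abs_mult abs_of_pos right_diff_distrib)
  then show ?thesis using assms(1) by (simp add: field_simps)
qed

text \<open>Rounding the weights and the coordinates of the atoms leaves, for each of these finitely
  many numbers, a count of values linear in \<open>n\<close>, so the number of rounded vectors is
  polynomial in \<open>n\<close>. The net consists of representatives of the rounding classes and
  not of grid points, because grid points may leave \<open>T\<close> or violate the sum condition on
  the weights. The constants \<open>c\<close> and \<open>D\<close> are independent of
  \<open>n\<close>.\<close>

lemma polynomial_net:
  fixes T :: "(real ^ 'm) set"
  assumes "bounded T"
  obtains c D where "\<And>n. n \<ge> 1 \<Longrightarrow> \<exists>S\<subseteq>mixture_params T k. finite S \<and> real (card S) \<le> c * real n ^ D \<and>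
      (\<forall>\<psi>\<in>mixture_params T k. \<exists>s\<in>S. close_params k (1 / real n) \<psi> s)"
proof -
  obtain B0 where B0: "\<And>\<theta>. \<theta> \<in> T \<Longrightarrow> norm \<theta> \<le> B0"
    using assms by (auto simp: bounded_iff)
  define m where "m = CARD('m)"
  have m: "m > 0" by (simp add: m_def)
  \<comment> \<open>With \<open>max 1 B0\<close> a single \<open>b\<close> bounds both the weights,
    which are at most 1, and the atom coordinates scaled by \<open>m\<close>.\<close>
  obtain b :: nat where b: "real b \<ge> real m * max 1 B0 + 1" using real_arch_simple by blast
  have b1: "1 \<le> real b" "real m * B0 + 1 \<le> real b"
  proof -
    have "real m * 1 \<le> real m * max 1 B0" "real m * B0 \<le> real m * max 1 B0"
      by (rule mult_left_mono; simp)+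
    then show "1 \<le> real b" "real m * B0 + 1 \<le> real b" using b by auto
  qed
  \<comment> \<open>An index \<open>(z, None)\<close> stands for the weight of component
    \<open>z\<close>, and \<open>(z, Some j)\<close> for coordinate \<open>j\<close> of its atom.
    Coordinates are rounded at the finer scale \<open>n * m\<close>, so that the \<open>m\<close>
    errors of one atom add up to at most \<open>1 / n\<close>.\<close>
  define I where "I = {1..k} \<times> (UNIV :: 'm option set)"
  have finI: "finite I" by (simp add: I_def)
  define h where "h n \<psi> = (\<lambda>(z, i)\<in>I. case i of None \<Rightarrow> \<lfloor>real n * fst \<psi> z\<rfloor>
      | Some j \<Rightarrow> \<lfloor>real n * real m * (snd \<psi> z $ j)\<rfloor>)"
    for n and \<psi> :: "(nat \<Rightarrow> real) \<times> (nat \<Rightarrow> real ^ 'm)"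
  show ?thesis
  proof (rule that[where c = "real (2 * b + 1) ^ card I" and D = "card I"])
    fix n :: nat assume n: "n \<ge> 1"
    let ?R = "{- int (b * n)..int (b * n)}"
    let ?A = "mixture_params T k"
    have sub: "h n ` ?A \<subseteq> I \<rightarrow>\<^sub>E ?R"
    proof (rule image_subsetI)
      fix \<psi> assume \<psi>: "\<psi> \<in> ?A"
      have None: "\<lfloor>real n * fst \<psi> z\<rfloor> \<in> ?R" if "z \<in> {1..k}" for z
      proof -
        have "0 \<le> real n * fst \<psi> z" "real n * fst \<psi> z \<le> real n * real b"
          using mixture_params_D(1)[OF \<psi> that] b1 by (auto intro!: mult_left_mono)
        then show ?thesis by (simp add: le_floor_iff floor_le_iff mult.commute)
      qed
      have Some: "\<lfloor>real n * real m * (snd \<psi> z $ j)\<rfloor> \<in> ?R" if "z \<in> {1..k}" for z j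
      proof -
        have "\<bar>snd \<psi> z $ j\<bar> \<le> B0"
          using B0[OF mixture_params_D(2)[OF \<psi> that]] component_le_norm_cart order_trans by blast
        then have "real n * real m * \<bar>snd \<psi> z $ j\<bar> \<le> real n * real m * B0"
          by (intro mult_left_mono) auto
        also have "\<dots> \<le> real n * (real b - 1)"
          using b1 by (subst mult.assoc, intro mult_left_mono) auto
        finally have "\<bar>real n * real m * (snd \<psi> z $ j)\<bar> \<le> real n * real b - real n"
          by (simp add: abs_mult right_diff_distrib)
        then have "- (real b * real n) \<le> real n * real m * (snd \<psi> z $ j)"
            "real n * real m * (snd \<psi> z $ j) < real b * real n + 1"
          using n by (auto simp: abs_le_iff mult.commute)
        then show ?thesis by (simp add: le_floor_iff floor_le_iff)
      qed
      show "h n \<psi> \<in> I \<rightarrow>\<^sub>E ?R"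
        using None Some by (auto simp: h_def I_def split: option.split)
    qed
    have fin: "finite (I \<rightarrow>\<^sub>E ?R)" by (intro finite_PiE finI) auto
    have finh: "finite (h n ` ?A)" using finite_subset[OF sub fin] .
    obtain S where S: "S \<subseteq> ?A" "finite S" "card S \<le> card (h n ` ?A)"
        "\<And>a. a \<in> ?A \<Longrightarrow> \<exists>s\<in>S. h n s = h n a"
      using ex_transversal[OF finh] by metis
    have "card (I \<rightarrow>\<^sub>E ?R) = (2 * b * n + 1) ^ card I"
      by (simp add: card_PiE finI nat_add_distrib nat_mult_distrib mult.assoc)
    then have "card S \<le> (2 * b * n + 1) ^ card I"
      using S(3) card_mono[OF fin sub] by simp
    also have "\<dots> \<le> ((2 * b + 1) * n) ^ card I"
      using n by (intro power_mono) auto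
    finally have "real (card S) \<le> real (((2 * b + 1) * n) ^ card I)"
      by (simp only: of_nat_le_iff)
    then have card: "real (card S) \<le> real (2 * b + 1) ^ card I * real n ^ card I"
      by (simp only: of_nat_mult of_nat_power power_mult_distrib)
    have "close_params k (1 / real n) \<psi> s" if hs: "h n s = h n \<psi>" for \<psi> s
      unfolding close_params_def
    proof (intro ballI conjI)
      fix z assume z: "z \<in> {1..k}"
      have "h n s (z, None) = h n \<psi> (z, None)" using hs by simp
      then show "\<bar>fst \<psi> z - fst s z\<bar> \<le> 1 / real n"
        using z n by (intro abs_diff_le_of_floor_eq) (auto simp: h_def I_def)
      have "\<bar>(snd \<psi> z - snd s z) $ j\<bar> \<le> 1 / (real n * real m)" for j
      proof -
        have "h n s (z, Some j) = h n \<psi> (z, Some j)" using hs by simp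
        then show ?thesis
          unfolding vector_minus_component
          using z n m by (intro abs_diff_le_of_floor_eq) (auto simp: h_def I_def)
      qed
      then have "(\<Sum>j\<in>UNIV. \<bar>(snd \<psi> z - snd s z) $ j\<bar>) \<le> (\<Sum>j\<in>(UNIV::'m set). 1 / (real n * real m))"
        by (intro sum_mono) auto
      also have "\<dots> = 1 / real n" using m by (simp add: m_def)
      finally show "(\<Sum>j\<in>UNIV. \<bar>(snd \<psi> z - snd s z) $ j\<bar>) \<le> 1 / real n" .
    qed
    then have "\<exists>s\<in>S. close_params k (1 / real n) \<psi> s" if "\<psi> \<in> ?A" for \<psi>
      using S(4)[OF that] by blast
    with S(1,2) card show "\<exists>S\<subseteq>?A. finite S \<and> real (card S) \<le> real (2 * b + 1) ^ card I * real n ^ card I \<and>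
        (\<forall>\<psi>\<in>?A. \<exists>s\<in>S. close_params k (1 / real n) \<psi> s)"
      by blast
  qed
qed

section \<open>Topology, positivity, nesting and perturbation of mixtures\<close>

text \<open>Extensionality amounts to the singleton factor \<open>{undefined}\<close> at every index
  outside \<open>I\<close>. This makes the set a full product of compact sets, to which Tychonoff's
  theorem applies.\<close>

lemma compact_PiE_extensional:
  fixes S :: "'i \<Rightarrow> 'a::topological_space set"
  assumes "\<And>i. i \<in> I \<Longrightarrow> compact (S i)"
  shows "compact (PiE I S)"
proof -
  have eq: "PiE I S = PiE UNIV (\<lambda>i. if i \<in> I then S i else {undefined})"
    by (auto simp: PiE_iff extensional_def split: if_splits)
  show ?thesis
    using assms unfolding eq compactin_euclidean_iff[symmetric] euclidean_product_topology[symmetric]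
    by (subst compactin_PiE) auto
qed

lemma compact_mixture_params:
  fixes T :: "'t::topological_space set"
  assumes "compact T"
  shows "compact (mixture_params T k)"
proof -
  have eq: "{\<pi> \<in> {1..k} \<rightarrow>\<^sub>E {0..1::real}. (\<Sum>z=1..k. \<pi> z) = 1} =
      ({1..k} \<rightarrow>\<^sub>E {0..1}) \<inter> {\<pi>. (\<Sum>z=1..k. \<pi> z) = 1}" by auto
  have "closed {\<pi> :: nat \<Rightarrow> real. (\<Sum>z=1..k. \<pi> z) = 1}"
    by (intro closed_Collect_eq continuous_on_sum continuous_on_const)
       (rule continuous_on_product_coordinates)
  then show ?thesis
    unfolding mixture_params_def eq
    by (intro compact_Times compact_Int_closed compact_PiE_extensional assms) auto
qed

lemma continuous_on_mixture:
  fixes T :: "'t::topological_space set"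
  assumes "continuous_on T (\<phi> x)"
  shows "continuous_on (mixture_params T k) (\<lambda>\<psi>. mixture \<phi> k \<psi> x)"
  unfolding mixture_def
proof (intro continuous_on_sum continuous_on_mult)
  fix z assume z: "z \<in> {1..k}"
  show "continuous_on (mixture_params T k) (\<lambda>\<psi>. fst \<psi> z)"
    by (rule continuous_on_product_then_coordinatewise[OF continuous_on_fst[OF continuous_on_id]])
  show "continuous_on (mixture_params T k) (\<lambda>\<psi>. \<phi> x (snd \<psi> z))"
    by (rule continuous_on_compose2[OF assms
          continuous_on_product_then_coordinatewise[OF continuous_on_snd[OF continuous_on_id]]])
       (use z in \<open>auto simp: mixture_params_def PiE_iff\<close>)
qed

text \<open>The weights sum to 1, so some weight is nonzero; its term is strictly positive and the
  others are nonnegative.\<close>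

lemma mixture_pos:
  assumes "\<And>\<theta>. \<theta> \<in> T \<Longrightarrow> \<phi> x \<theta> > 0" "\<psi> \<in> mixture_params T k"
  shows "mixture \<phi> k \<psi> x > 0"
proof -
  note D = mixture_params_D[OF assms(2)]
  have nn: "fst \<psi> z * \<phi> x (snd \<psi> z) \<ge> 0" if "z \<in> {1..k}" for z
    using D(1,2)[OF that] assms(1) by (intro mult_nonneg_nonneg) (auto intro: less_imp_le)
  obtain z where z: "z \<in> {1..k}" "fst \<psi> z \<noteq> 0"
    using D(3) sum.neutral[of "{1..k}" "fst \<psi>"] by fastforce
  then have "fst \<psi> z * \<phi> x (snd \<psi> z) > 0"
    using D(1,2)[OF z(1)] z(2) assms(1) by (intro mult_pos_pos) auto
  with z nn show ?thesis
    unfolding mixture_def by (intro sum_pos2[of _ z]) auto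
qed

lemma mixture_params_nonempty:
  assumes "t \<in> T" "k \<ge> 1"
  shows "mixture_params T k \<noteq> {}"
proof -
  have "((\<lambda>z\<in>{1..k}. if z = 1 then 1 else 0), (\<lambda>z\<in>{1..k}. t)) \<in> mixture_params T k"
    using assms by (auto simp: mixture_params_def sum.delta)
  then show ?thesis by blast
qed

text \<open>A mixture is padded with components of weight zero. Their atoms repeat the first atom,
  which lies in \<open>T\<close> because \<open>k \<ge> 1\<close>. Hence a density outside the class
  of order \<open>k0 - 1\<close> is outside every class of smaller positive order.\<close>

lemma mixture_class_mono:
  assumes "k \<ge> 1" "k \<le> k'"
  shows "mixture_class \<mu> T \<phi> k \<subseteq> mixture_class \<mu> T \<phi> k'"
proof
  fix f assume "f \<in> mixture_class \<mu> T \<phi> k"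
  then obtain \<psi> where \<psi>: "\<psi> \<in> mixture_params T k" "AE x in \<mu>. f x = mixture \<phi> k \<psi> x"
    by (auto simp: mixture_class_def)
  note D = mixture_params_D[OF \<psi>(1)]
  define \<psi>' where "\<psi>' = ((\<lambda>z\<in>{1..k'}. if z \<le> k then fst \<psi> z else 0),
    (\<lambda>z\<in>{1..k'}. if z \<le> k then snd \<psi> z else snd \<psi> 1))"
  have sum_eq: "(\<Sum>z=1..k'. if z \<le> k then g z else 0) = (\<Sum>z=1..k. g z)" for g :: "nat \<Rightarrow> real"
    using assms by (intro sum.mono_neutral_cong_right) auto
  have "(\<Sum>z=1..k'. fst \<psi>' z) = 1"
    using D(3) sum_eq[of "fst \<psi>"] by (simp add: \<psi>'_def)
  then have "\<psi>' \<in> mixture_params T k'"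
    using D(1,2) assms by (auto simp: mixture_params_def \<psi>'_def)
  moreover have "mixture \<phi> k' \<psi>' x = mixture \<phi> k \<psi> x" for x
  proof -
    have "mixture \<phi> k' \<psi>' x = (\<Sum>z=1..k'. if z \<le> k then fst \<psi> z * \<phi> x (snd \<psi> z) else 0)"
      unfolding mixture_def by (intro sum.cong) (auto simp: \<psi>'_def)
    then show ?thesis by (simp only: sum_eq mixture_def)
  qed
  ultimately show "f \<in> mixture_class \<mu> T \<phi> k'"
    using \<psi>(2) unfolding mixture_class_def mem_Collect_eq by (intro bexI[of _ \<psi>']) simp_all
qed

text \<open>The error \<open>\<delta> (k + 1) G\<close> splits into \<open>\<delta> G\<close> for each of the \<open>k\<close> weights and \<open>\<delta> G\<close> for all atoms together.\<close>

lemma mixture_le_of_close: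
  assumes \<psi>: "\<psi> \<in> mixture_params T k" and \<psi>': "\<psi>' \<in> mixture_params T k"
    and close: "close_params k \<delta> \<psi> \<psi>'" and "L \<ge> 0"
    and lip: "\<And>\<theta>1 \<theta>2. \<theta>1 \<in> T \<Longrightarrow> \<theta>2 \<in> T \<Longrightarrow>
          \<bar>\<phi> x \<theta>1 - \<phi> x \<theta>2\<bar> \<le> L * (\<Sum>j\<in>UNIV. \<bar>(\<theta>1 - \<theta>2) $ j\<bar>)"
    and bd: "\<And>\<theta>. \<theta> \<in> T \<Longrightarrow> 0 \<le> \<phi> x \<theta> \<and> \<phi> x \<theta> + L \<le> G"
  shows "mixture \<phi> k \<psi> x \<le> mixture \<phi> k \<psi>' x + \<delta> * real (k + 1) * G"
proof -
  note D = mixture_params_D[OF \<psi>] and D' = mixture_params_D[OF \<psi>']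
  have k: "k \<ge> 1" using D(3) by (cases k) auto
  \<comment> \<open>The weights sum to 1, so component 1 exists, and closeness there makes
    \<open>\<delta>\<close> dominate an absolute value.\<close>
  have \<delta>: "\<delta> \<ge> 0" using close k unfolding close_params_def
    by (meson abs_ge_zero atLeastAtMost_iff order.trans order_refl)
  have G: "0 \<le> G" "L \<le> G" using bd[OF D(2)[of 1]] \<open>L \<ge> 0\<close> k by auto
  \<comment> \<open>The difference of the two products is split as
    \<open>(p - p') * a + p' * (a - a')\<close>, with weights \<open>p\<close>, \<open>p'\<close>
    and kernel values \<open>a\<close>, \<open>a'\<close>. The first summand is controlled by
    \<open>a \<le> G\<close>, the second by the Lipschitz bound and
    \<open>L \<le> G\<close>.\<close>
  have "fst \<psi> z * \<phi> x (snd \<psi> z) \<le> fst \<psi>' z * \<phi> x (snd \<psi>' z) + (\<delta> * G + fst \<psi>' z * (\<delta> * G))"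
    if z: "z \<in> {1..k}" for z
  proof -
    have c: "\<bar>fst \<psi> z - fst \<psi>' z\<bar> \<le> \<delta>"
        "(\<Sum>j\<in>UNIV. \<bar>(snd \<psi> z - snd \<psi>' z) $ j\<bar>) \<le> \<delta>"
      using close z unfolding close_params_def by blast+
    have "(fst \<psi> z - fst \<psi>' z) * \<phi> x (snd \<psi> z) \<le> \<delta> * G"
    proof (intro mult_mono)
      show "fst \<psi> z - fst \<psi>' z \<le> \<delta>"
        using c(1) by linarith
    qed (use bd[OF D(2)[OF z]] \<delta> \<open>L \<ge> 0\<close> in auto)
    moreover have "\<phi> x (snd \<psi> z) - \<phi> x (snd \<psi>' z) \<le> \<delta> * G"
    proof -
      have "\<phi> x (snd \<psi> z) - \<phi> x (snd \<psi>' z) \<le> L * (\<Sum>j\<in>UNIV. \<bar>(snd \<psi> z - snd \<psi>' z) $ j\<bar>)"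
        using lip[OF D(2)[OF z] D'(2)[OF z]] by linarith
      also have "\<dots> \<le> G * \<delta>"
        using c(2) G by (intro mult_mono) (auto intro: sum_nonneg simp del: vector_minus_component)
      finally show ?thesis by (simp add: mult.commute)
    qed
    then have "fst \<psi>' z * (\<phi> x (snd \<psi> z) - \<phi> x (snd \<psi>' z)) \<le> fst \<psi>' z * (\<delta> * G)"
      using D'(1)[OF z] by (intro mult_left_mono) auto
    ultimately show ?thesis by (simp add: algebra_simps)
  qed
  then have "mixture \<phi> k \<psi> x \<le>
      (\<Sum>z=1..k. fst \<psi>' z * \<phi> x (snd \<psi>' z) + (\<delta> * G + fst \<psi>' z * (\<delta> * G)))"
    unfolding mixture_def by (intro sum_mono) auto
  also have "\<dots> = mixture \<phi> k \<psi>' x + \<delta> * real (k + 1) * G"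
  proof -
    have "(\<Sum>z=1..k. \<delta> * G + fst \<psi>' z * (\<delta> * G)) = real k * (\<delta> * G) + (\<Sum>z=1..k. fst \<psi>' z) * (\<delta> * G)"
      by (simp only: sum.distrib sum_distrib_right) simp
    then show ?thesis
      unfolding mixture_def D'(3) sum.distrib[of "\<lambda>z. fst \<psi>' z * \<phi> x (snd \<psi>' z)"] by (simp add: algebra_simps)
  qed
  finally show ?thesis .
qed

text \<open>Closeness restricts finitely many coordinates, so strict inequalities on them give an
  open set in the product topology. These sets form the open cover in the underfitting
  argument.\<close>

lemma open_close_params:
  fixes \<psi> :: "(nat \<Rightarrow> real) \<times> (nat \<Rightarrow> real ^ 'm)"
  assumes "\<delta> > 0"
  obtains U where "open U" "\<psi> \<in> U" "\<And>\<psi>'. \<psi>' \<in> U \<Longrightarrow> close_params k \<delta> \<psi>' \<psi>"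
proof
  define A where "A z = {\<psi>' :: (nat \<Rightarrow> real) \<times> (nat \<Rightarrow> real ^ 'm). \<bar>fst \<psi>' z - fst \<psi> z\<bar> < \<delta>}" for z
  define B where "B z = {\<psi>' :: (nat \<Rightarrow> real) \<times> (nat \<Rightarrow> real ^ 'm).
      (\<Sum>j\<in>UNIV. \<bar>(snd \<psi>' z - snd \<psi> z) $ j\<bar>) < \<delta>}" for z
  have c1: "continuous_on UNIV (\<lambda>\<psi>' :: (nat \<Rightarrow> real) \<times> (nat \<Rightarrow> real ^ 'm). fst \<psi>' z)" for z
    by (rule continuous_on_product_then_coordinatewise[OF continuous_on_fst[OF continuous_on_id]])
  have c2: "continuous_on UNIV (\<lambda>\<psi>' :: (nat \<Rightarrow> real) \<times> (nat \<Rightarrow> real ^ 'm). snd \<psi>' z)" for z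
    by (rule continuous_on_product_then_coordinatewise[OF continuous_on_snd[OF continuous_on_id]])
  have "open (A z)" for z
    unfolding A_def
    by (intro open_Collect_less continuous_on_rabs continuous_on_diff c1 continuous_on_const)
  moreover have "open (B z)" for z
    unfolding B_def
    by (intro open_Collect_less continuous_on_sum continuous_on_rabs continuous_on_component
        continuous_on_diff c2 continuous_on_const)
  ultimately show "open (\<Inter>z\<in>{1..k}. A z \<inter> B z)" by (intro open_INT) auto
  show "\<psi> \<in> (\<Inter>z\<in>{1..k}. A z \<inter> B z)" using assms by (simp add: A_def B_def)
  show "close_params k \<delta> \<psi>' \<psi>" if "\<psi>' \<in> (\<Inter>z\<in>{1..k}. A z \<inter> B z)" for \<psi>'
    using that unfolding close_params_def A_def B_def by (auto intro: less_imp_le simp del: vector_minus_component)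
qed

section \<open>Affinity of two densities\<close>

text \<open>The geometric mean is dominated by the integrable arithmetic mean.\<close>

lemma integrable_sqrt_mult:
  fixes f g :: "'a \<Rightarrow> real"
  assumes "integrable M f" "integrable M g" "\<And>x. x \<in> space M \<Longrightarrow> 0 \<le> f x" "\<And>x. x \<in> space M \<Longrightarrow> 0 \<le> g x"
  shows "integrable M (\<lambda>x. sqrt (f x * g x))"
proof (rule Bochner_Integration.integrable_bound)
  show "integrable M (\<lambda>x. (f x + g x) / 2)" using assms(1,2) by auto
  show "AE x in M. norm (sqrt (f x * g x)) \<le> norm ((f x + g x) / 2)"
  proof (rule AE_I2)
    fix x assume "x \<in> space M"
    then show "norm (sqrt (f x * g x)) \<le> norm ((f x + g x) / 2)"
      using assms(3,4)[of x] arith_geo_mean_sqrt[of "f x" "g x"] by simp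
  qed
qed (use assms(1,2)[THEN borel_measurable_integrable] in measurable)

text \<open>One minus the affinity is the integral of \<open>(f + g) / 2 - sqrt (f * g)\<close>,
  that is, half the integral of the square of \<open>sqrt f - sqrt g\<close> (the squared Hellinger
  distance). It vanishes only if \<open>f\<close> and \<open>g\<close> agree almost
  everywhere.\<close>

lemma affinity_less_one:
  fixes f g :: "'a \<Rightarrow> real"
  assumes f: "integrable M f" "(\<integral>x. f x \<partial>M) = 1" and g: "integrable M g" "(\<integral>x. g x \<partial>M) = 1"
    and nn: "\<And>x. x \<in> space M \<Longrightarrow> 0 \<le> f x" "\<And>x. x \<in> space M \<Longrightarrow> 0 \<le> g x"
    and neq: "\<not> (AE x in M. f x = g x)"
  shows "(\<integral>x. sqrt (f x * g x) \<partial>M) < 1"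
proof -
  note int = integrable_sqrt_mult[OF f(1) g(1) nn]
  let ?d = "\<lambda>x. (f x + g x) / 2 - sqrt (f x * g x)"
  have d_int: "integrable M ?d" using f g int by auto
  have d_nn: "AE x in M. 0 \<le> ?d x"
    using nn arith_geo_mean_sqrt by (intro AE_I2) simp
  have d_eq: "(\<integral>x. ?d x \<partial>M) = 1 - (\<integral>x. sqrt (f x * g x) \<partial>M)"
    using f g int by simp
  have "(\<integral>x. ?d x \<partial>M) \<noteq> 0"
  proof
    assume "(\<integral>x. ?d x \<partial>M) = 0"
    then have "AE x in M. ?d x = 0"
      using integral_nonneg_eq_0_iff_AE[OF d_int d_nn] by simp
    then have "AE x in M. f x = g x"
    proof (rule AE_mp, intro AE_I2 impI)
      fix x assume x: "x \<in> space M" and "?d x = 0"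
      then have "(sqrt (f x) - sqrt (g x))\<^sup>2 = 0"
        using nn[OF x] by (simp add: power2_diff real_sqrt_mult algebra_simps)
      then show "f x = g x" by simp
    qed
    then show False using neq by simp
  qed
  moreover have "(\<integral>x. ?d x \<partial>M) \<ge> 0" by (rule integral_nonneg_AE[OF d_nn])
  ultimately show ?thesis using d_eq by simp
qed

section \<open>Products over an IID sample and a union bound\<close>

locale iid_density = prob_space M for M :: "'w measure" +
  fixes \<mu> :: "'x measure" and f0 :: "'x \<Rightarrow> real" and Xs :: "nat \<Rightarrow> 'w \<Rightarrow> 'x"
  assumes f0_measurable [measurable]: "f0 \<in> borel_measurable \<mu>"
    and f0_pos: "x \<in> space \<mu> \<Longrightarrow> f0 x > 0"
    and indep: "indep_vars (\<lambda>_. \<mu>) Xs {1..}"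
    and distr_Xs: "i \<ge> 1 \<Longrightarrow> distr M \<mu> (Xs i) = density \<mu> (\<lambda>x. ennreal (f0 x))"
begin

lemma Xs_measurable: "i \<ge> 1 \<Longrightarrow> Xs i \<in> measurable M \<mu>"
  using indep by (auto simp: indep_vars_def)

lemma Xs_space: "i \<ge> 1 \<Longrightarrow> \<omega> \<in> space M \<Longrightarrow> Xs i \<omega> \<in> space \<mu>"
  using Xs_measurable measurable_space by metis

lemma nn_integral_f0: "(\<integral>\<^sup>+x. ennreal (f0 x) \<partial>\<mu>) = 1"
proof -
  interpret D: prob_space "distr M \<mu> (Xs 1)"
    by (rule prob_space_distr) (simp add: Xs_measurable)
  show ?thesis
    using D.emeasure_space_1 unfolding distr_Xs[OF order_refl]
    by (simp add: emeasure_density cong: nn_integral_cong)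
qed

lemma integrable_f0: "integrable \<mu> f0" and integral_f0: "(\<integral>x. f0 x \<partial>\<mu>) = 1"
proof -
  have nn: "AE x in \<mu>. 0 \<le> f0 x" using f0_pos by (intro AE_I2) (simp add: less_imp_le)
  show "integrable \<mu> f0"
    using nn_integral_f0 nn by (intro integrableI_nonneg) auto
  show "(\<integral>x. f0 x \<partial>\<mu>) = 1"
    using nn_integral_f0 nn by (simp add: integral_eq_nn_integral)
qed

text \<open>The law of each sample point has a density with respect to \<open>\<mu>\<close>, so it
  ignores \<open>\<mu>\<close>-null sets, and countably many indices can be treated at once.\<close>

lemma AE_Xs:
  assumes "AE x in \<mu>. P x"
  shows "AE \<omega> in M. \<forall>i\<ge>1. P (Xs i \<omega>)"
proof -
  have "AE \<omega> in M. P (Xs i \<omega>)" if "i \<ge> 1" for i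
  proof -
    have "AE x in distr M \<mu> (Xs i). P x"
      unfolding distr_Xs[OF that] using assms by (subst AE_density) auto
    then show ?thesis by (rule AE_distrD[OF Xs_measurable[OF that]])
  qed
  then show ?thesis by (simp add: AE_all_countable)
qed

lemma nn_integral_prod:
  assumes g [measurable]: "g \<in> borel_measurable \<mu>"
  shows "(\<integral>\<^sup>+\<omega>. (\<Prod>i=1..n. g (Xs i \<omega>)) \<partial>M) = (\<integral>\<^sup>+x. ennreal (f0 x) * g x \<partial>\<mu>) ^ n"
proof -
  have "indep_vars (\<lambda>_. borel) (\<lambda>i \<omega>. g (Xs i \<omega>)) {1..n}"
    by (rule indep_vars_compose2[OF indep_vars_subset[OF indep]]) (auto simp: g)
  then have "(\<integral>\<^sup>+\<omega>. (\<Prod>i=1..n. g (Xs i \<omega>)) \<partial>M) = (\<Prod>i=1..n. \<integral>\<^sup>+\<omega>. g (Xs i \<omega>) \<partial>M)"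
    by (intro indep_vars_nn_integral) auto
  also have "\<dots> = (\<Prod>i=1..n. \<integral>\<^sup>+x. ennreal (f0 x) * g x \<partial>\<mu>)"
  proof (rule prod.cong[OF refl])
    fix i assume "i \<in> {1..n}"
    then have i: "i \<ge> 1" by simp
    have "(\<integral>\<^sup>+\<omega>. g (Xs i \<omega>) \<partial>M) = (\<integral>\<^sup>+x. g x \<partial>distr M \<mu> (Xs i))"
      by (rule nn_integral_distr[OF Xs_measurable[OF i], symmetric]) (simp add: g)
    also have "\<dots> = (\<integral>\<^sup>+x. ennreal (f0 x) * g x \<partial>\<mu>)"
      unfolding distr_Xs[OF i] by (intro nn_integral_density) auto
    finally show "(\<integral>\<^sup>+\<omega>. g (Xs i \<omega>) \<partial>M) = (\<integral>\<^sup>+x. ennreal (f0 x) * g x \<partial>\<mu>)" .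
  qed
  finally show ?thesis by simp
qed

text \<open>By independence each product has expectation at most \<open>r ^ n\<close>. Markov's
  inequality bounds the probability that it reaches \<open>t\<close>, and a union bound over
  \<open>J\<close> gives the factor \<open>card J\<close>.\<close>

lemma prob_ex_prod_ge:
  assumes J: "finite J" and g: "\<And>j. j \<in> J \<Longrightarrow> g j \<in> borel_measurable \<mu>"
    and nn: "\<And>j x. j \<in> J \<Longrightarrow> x \<in> space \<mu> \<Longrightarrow> 0 \<le> g j x"
    and r: "\<And>j. j \<in> J \<Longrightarrow> (\<integral>\<^sup>+x. ennreal (f0 x * g j x) \<partial>\<mu>) \<le> ennreal r" "r \<ge> 0" and t: "t > 0"
  shows "{\<omega>\<in>space M. \<exists>j\<in>J. t \<le> (\<Prod>i=1..n. g j (Xs i \<omega>))} \<in> events" (is "?E \<in> _")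
    and "prob {\<omega>\<in>space M. \<exists>j\<in>J. t \<le> (\<Prod>i=1..n. g j (Xs i \<omega>))} \<le> real (card J) * r ^ n / t"
proof -
  let ?A = "\<lambda>j. {\<omega>\<in>space M. t \<le> (\<Prod>i=1..n. g j (Xs i \<omega>))}"
  have meas: "(\<lambda>\<omega>. \<Prod>i=1..n. g j (Xs i \<omega>)) \<in> borel_measurable M" if "j \<in> J" for j
    by (intro borel_measurable_prod measurable_compose[OF Xs_measurable g[OF that]]) auto
  have A: "?A j \<in> events" if "j \<in> J" for j
    using meas[OF that] by measurable
  have eq: "?E = (\<Union>j\<in>J. ?A j)" by auto
  show "?E \<in> events" unfolding eq using J A by blast
  have "prob (?A j) \<le> r ^ n / t" if j: "j \<in> J" for j
  proof -
    have prod_nn: "0 \<le> (\<Prod>i=1..n. g j (Xs i \<omega>))" if "\<omega> \<in> space M" for \<omega>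
      by (intro prod_nonneg nn j Xs_space that) auto
    \<comment> \<open>The event is brought into the form \<open>1 \<le> c * u\<close> of
      \<open>nn_integral_Markov_inequality\<close>, with \<open>c = 1 / t\<close>.\<close>
    have "emeasure M (?A j) \<le> emeasure M {\<omega>\<in>space M. 1 \<le> ennreal (1 / t) * (\<Prod>i=1..n. ennreal (g j (Xs i \<omega>)))}"
    proof (rule emeasure_mono)
      show "?A j \<subseteq> {\<omega>\<in>space M. 1 \<le> ennreal (1 / t) * (\<Prod>i=1..n. ennreal (g j (Xs i \<omega>)))}"
      proof safe
        fix \<omega> assume \<omega>: "\<omega> \<in> space M" "t \<le> (\<Prod>i=1..n. g j (Xs i \<omega>))"
        have "(\<Prod>i=1..n. ennreal (g j (Xs i \<omega>))) = ennreal (\<Prod>i=1..n. g j (Xs i \<omega>))"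
          by (intro prod_ennreal nn j Xs_space \<omega>(1)) auto
        then have "ennreal (1 / t) * (\<Prod>i=1..n. ennreal (g j (Xs i \<omega>))) = ennreal (1 / t * (\<Prod>i=1..n. g j (Xs i \<omega>)))"
          using t prod_nn[OF \<omega>(1)] by (simp add: ennreal_mult'[symmetric])
        moreover have "1 \<le> 1 / t * (\<Prod>i=1..n. g j (Xs i \<omega>))" using \<omega>(2) t by (simp add: field_simps)
        ultimately show "1 \<le> ennreal (1 / t) * (\<Prod>i=1..n. ennreal (g j (Xs i \<omega>)))"
          by (simp only: ennreal_1[symmetric] ennreal_leI)
      qed
      show "{\<omega>\<in>space M. 1 \<le> ennreal (1 / t) * (\<Prod>i=1..n. ennreal (g j (Xs i \<omega>)))} \<in> events"
        using measurable_compose[OF Xs_measurable g[OF j]] by measurable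
    qed
    also have "\<dots> \<le> ennreal (1 / t) * (\<integral>\<^sup>+\<omega>. (\<Prod>i=1..n. ennreal (g j (Xs i \<omega>))) * indicator (space M) \<omega> \<partial>M)"
      using measurable_compose[OF Xs_measurable g[OF j]]
      by (intro nn_integral_Markov_inequality) (auto intro!: borel_measurable_prod_ennreal measurable_compose[OF _ measurable_ennreal])
    also have "(\<integral>\<^sup>+\<omega>. (\<Prod>i=1..n. ennreal (g j (Xs i \<omega>))) * indicator (space M) \<omega> \<partial>M) =
        (\<integral>\<^sup>+\<omega>. (\<Prod>i=1..n. ennreal (g j (Xs i \<omega>))) \<partial>M)"
      by (intro nn_integral_cong) auto
    also have "\<dots> = (\<integral>\<^sup>+x. ennreal (f0 x) * ennreal (g j x) \<partial>\<mu>) ^ n"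
      using g[OF j] by (intro nn_integral_prod[where g = "\<lambda>x. ennreal (g j x)"]) measurable
    also have "(\<integral>\<^sup>+x. ennreal (f0 x) * ennreal (g j x) \<partial>\<mu>) = (\<integral>\<^sup>+x. ennreal (f0 x * g j x) \<partial>\<mu>)"
      using nn[OF j] f0_pos by (intro nn_integral_cong) (simp add: ennreal_mult less_imp_le)
    also have "ennreal (1 / t) * \<dots> ^ n \<le> ennreal (1 / t) * ennreal r ^ n"
      by (intro mult_left_mono power_mono r j) auto
    also have "\<dots> = ennreal (r ^ n / t)"
      using r(2) t by (simp add: ennreal_power ennreal_mult'[symmetric])
    finally show ?thesis
      using r(2) t by (simp add: emeasure_eq_measure)
  qed
  then have "(\<Sum>j\<in>J. prob (?A j)) \<le> real (card J) * (r ^ n / t)"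
    by (intro sum_bounded_above) auto
  moreover have "prob ?E \<le> (\<Sum>j\<in>J. prob (?A j))"
    unfolding eq using J A by (intro finite_measure_subadditive_finite) auto
  ultimately show "prob ?E \<le> real (card J) * r ^ n / t" by simp
qed

end

section \<open>Mixture densities and their upper brackets\<close>

text \<open>With \<open>a\<close> a mixture, \<open>u\<close> a bracket above it and
  \<open>b\<close> the true density, a bound on the one bracket ratio controls the log-likelihood of
  every mixture below that bracket.\<close>

lemma sum_ln_le_of_prod_less:
  fixes a b u :: "'i \<Rightarrow> real"
  assumes "finite I" "\<And>i. i \<in> I \<Longrightarrow> 0 < a i" "\<And>i. i \<in> I \<Longrightarrow> 0 < b i" "\<And>i. i \<in> I \<Longrightarrow> a i \<le> u i"
    and "(\<Prod>i\<in>I. u i / b i) < t"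
  shows "(\<Sum>i\<in>I. ln (a i)) \<le> (\<Sum>i\<in>I. ln (b i)) + ln t"
proof -
  have ne: "a i / b i \<noteq> 0" if "i \<in> I" for i
    using assms(2,3)[OF that] by simp
  have pos: "0 < (\<Prod>i\<in>I. a i / b i)" using assms by (intro prod_pos) auto
  have "(\<Prod>i\<in>I. a i / b i) \<le> (\<Prod>i\<in>I. u i / b i)"
    using assms(2-4) by (intro prod_mono) (auto intro!: divide_right_mono divide_nonneg_nonneg intro: less_imp_le)
  then have "ln (\<Prod>i\<in>I. a i / b i) \<le> ln t"
    using pos assms(5) by simp
  moreover have "ln (\<Prod>i\<in>I. a i / b i) = (\<Sum>i\<in>I. ln (a i / b i))"
    using assms(1) ne by (intro ln_prod) auto
  moreover have "(\<Sum>i\<in>I. ln (a i / b i)) = (\<Sum>i\<in>I. ln (a i) - ln (b i))"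
  proof (rule sum.cong[OF refl])
    show "ln (a i / b i) = ln (a i) - ln (b i)" if "i \<in> I" for i
      using assms(2,3)[OF that] by (simp add: ln_div)
  qed
  ultimately show ?thesis by (simp add: sum_subtractf)
qed

lemma prod_sqrt: "(\<Prod>i\<in>A. sqrt (f i)) = sqrt (\<Prod>i\<in>A. f i)"
  by (induction A rule: infinite_finite_induct) (simp_all add: real_sqrt_mult)

locale iid_mixture = iid_density M \<mu> f0 Xs
  for M :: "'w measure" and \<mu> :: "'x measure" and f0 Xs +
  fixes T :: "(real ^ 'm) set" and \<phi> :: "'x \<Rightarrow> real ^ 'm \<Rightarrow> real" and L G :: "'x \<Rightarrow> real"
  assumes T_compact: "compact T" and T_nonempty: "T \<noteq> {}"
    and \<phi>_pos: "x \<in> space \<mu> \<Longrightarrow> \<theta> \<in> T \<Longrightarrow> 0 < \<phi> x \<theta>"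
    and \<phi>_cont: "x \<in> space \<mu> \<Longrightarrow> continuous_on T (\<phi> x)"
    and \<phi>_integral: "\<theta> \<in> T \<Longrightarrow> (\<integral>x. \<phi> x \<theta> \<partial>\<mu>) = 1"
    and L_nonneg: "x \<in> space \<mu> \<Longrightarrow> 0 \<le> L x"
    and G_int: "integrable \<mu> G"
    and \<phi>_lipschitz: "x \<in> space \<mu> \<Longrightarrow> \<theta>1 \<in> T \<Longrightarrow> \<theta>2 \<in> T \<Longrightarrow>
          \<bar>\<phi> x \<theta>1 - \<phi> x \<theta>2\<bar> \<le> L x * (\<Sum>j\<in>UNIV. \<bar>(\<theta>1 - \<theta>2) $ j\<bar>)"
    and \<phi>_bound: "x \<in> space \<mu> \<Longrightarrow> \<theta> \<in> T \<Longrightarrow> \<phi> x \<theta> + L x \<le> G x"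
begin

lemma G_nonneg: "x \<in> space \<mu> \<Longrightarrow> 0 \<le> G x"
proof -
  assume x: "x \<in> space \<mu>"
  obtain \<theta> where "\<theta> \<in> T" using T_nonempty by blast
  then show ?thesis using \<phi>_bound[OF x] \<phi>_pos[OF x] L_nonneg[OF x] by fastforce
qed

lemma G_measurable [measurable]: "G \<in> borel_measurable \<mu>"
  using G_int by auto

lemma mixture_positive: "\<psi> \<in> mixture_params T k \<Longrightarrow> x \<in> space \<mu> \<Longrightarrow> 0 < mixture \<phi> k \<psi> x"
  by (rule mixture_pos[where \<phi> = \<phi> and T = T]) (auto intro: \<phi>_pos)

text \<open>The Bochner integral of a non-integrable function is 0 by convention, so the value 1
  forces integrability.\<close>

lemma \<phi>_int: "\<theta> \<in> T \<Longrightarrow> integrable \<mu> (\<lambda>x. \<phi> x \<theta>)"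
  using \<phi>_integral not_integrable_integral_eq by fastforce

lemma mixture_integrable:
  assumes "\<psi> \<in> mixture_params T k"
  shows "integrable \<mu> (mixture \<phi> k \<psi>)"
  unfolding mixture_def
  by (intro Bochner_Integration.integrable_sum integrable_mult_right \<phi>_int mixture_params_D(2)[OF assms])

lemma mixture_measurable:
  assumes "\<psi> \<in> mixture_params T k"
  shows "mixture \<phi> k \<psi> \<in> borel_measurable \<mu>"
  using mixture_integrable[OF assms] by (rule borel_measurable_integrable)

lemma mixture_integral:
  assumes "\<psi> \<in> mixture_params T k"
  shows "(\<integral>x. mixture \<phi> k \<psi> x \<partial>\<mu>) = 1"
proof -
  have "(\<integral>x. mixture \<phi> k \<psi> x \<partial>\<mu>) = (\<Sum>z=1..k. \<integral>x. fst \<psi> z * \<phi> x (snd \<psi> z) \<partial>\<mu>)"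
    unfolding mixture_def
    by (intro Bochner_Integration.integral_sum integrable_mult_right \<phi>_int mixture_params_D(2)[OF assms])
  also have "\<dots> = (\<Sum>z=1..k. fst \<psi> z)"
    using \<phi>_integral mixture_params_D(2)[OF assms] by (intro sum.cong) auto
  finally show ?thesis using mixture_params_D(3)[OF assms] by simp
qed

definition bracket :: "nat \<Rightarrow> real \<Rightarrow> (nat \<Rightarrow> real) \<times> (nat \<Rightarrow> real ^ 'm) \<Rightarrow> 'x \<Rightarrow> real" where
  "bracket k \<delta> \<psi> x = mixture \<phi> k \<psi> x + \<delta> * real (k + 1) * G x"

lemma mixture_le_bracket:
  assumes "\<psi> \<in> mixture_params T k" "\<psi>' \<in> mixture_params T k" "close_params k \<delta> \<psi> \<psi>'" "x \<in> space \<mu>"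
  shows "mixture \<phi> k \<psi> x \<le> bracket k \<delta> \<psi>' x"
  unfolding bracket_def
proof (rule mixture_le_of_close[where \<phi> = \<phi> and T = T, OF assms(1-3) L_nonneg[OF assms(4)]])
  fix \<theta> assume \<theta>: "\<theta> \<in> T"
  show "0 \<le> \<phi> x \<theta> \<and> \<phi> x \<theta> + L x \<le> G x"
    using \<phi>_pos[OF assms(4) \<theta>] \<phi>_bound[OF assms(4) \<theta>] by simp
qed (rule \<phi>_lipschitz[OF assms(4)])

lemma bracket_nonneg:
  assumes "\<psi> \<in> mixture_params T k" "\<delta> \<ge> 0" "x \<in> space \<mu>"
  shows "0 \<le> bracket k \<delta> \<psi> x"
  unfolding bracket_def
  using mixture_positive[OF assms(1,3)] G_nonneg[OF assms(3)] assms(2)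
  by (intro add_nonneg_nonneg mult_nonneg_nonneg) auto

lemma bracket_integrable:
  assumes "\<psi> \<in> mixture_params T k"
  shows "integrable \<mu> (bracket k \<delta> \<psi>)"
  unfolding bracket_def
  by (intro Bochner_Integration.integrable_add mixture_integrable assms integrable_mult_right G_int)

lemma bracket_integral:
  assumes "\<psi> \<in> mixture_params T k"
  shows "(\<integral>x. bracket k \<delta> \<psi> x \<partial>\<mu>) = 1 + \<delta> * real (k + 1) * (\<integral>x. G x \<partial>\<mu>)"
  unfolding bracket_def
  by (subst Bochner_Integration.integral_add)
     (use mixture_integrable[OF assms] G_int mixture_integral[OF assms] in auto)

section \<open>Likelihood ratios are at most polynomial in the sample size\<close>

text \<open>The bound is uniform in \<open>\<psi>\<close> and holds for every \<open>k\<close>. Its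
  constant \<open>c\<close> is \<open>D + 1\<close>, where \<open>D\<close> is the degree of the
  net, because the bracket ratios stay below \<open>n ^ (D + 1)\<close> off the bad event.\<close>

lemma overfit:
  obtains c B where "\<And>n. B n \<in> events" "(\<lambda>n. prob (B n)) \<longlonglongrightarrow> 0"
    "\<And>n \<omega> \<psi>. n \<ge> 1 \<Longrightarrow> \<omega> \<in> space M - B n \<Longrightarrow> \<psi> \<in> mixture_params T k \<Longrightarrow>
      (\<Sum>i=1..n. ln (mixture \<phi> k \<psi> (Xs i \<omega>))) \<le> (\<Sum>i=1..n. ln (f0 (Xs i \<omega>))) + c * ln (real n)"
proof -
  obtain C D where "\<And>n. n \<ge> 1 \<Longrightarrow> \<exists>S\<subseteq>mixture_params T k. finite S \<and> real (card S) \<le> C * real n ^ D \<and>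
      (\<forall>\<psi>\<in>mixture_params T k. \<exists>s\<in>S. close_params k (1 / real n) \<psi> s)"
    using polynomial_net[OF compact_imp_bounded[OF T_compact], of k] by blast
  then obtain S where S: "\<And>n. n \<ge> 1 \<Longrightarrow> S n \<subseteq> mixture_params T k" "\<And>n. n \<ge> 1 \<Longrightarrow> finite (S n)"
      "\<And>n. n \<ge> 1 \<Longrightarrow> real (card (S n)) \<le> C * real n ^ D"
      "\<And>n \<psi>. n \<ge> 1 \<Longrightarrow> \<psi> \<in> mixture_params T k \<Longrightarrow> \<exists>s\<in>S n. close_params k (1 / real n) \<psi> s"
    by metis
  define u where "u n s = bracket k (1 / real n) s" for n s
  \<comment> \<open>The exponent is one more than the degree of the net, so the union bound over the
    net leaves a probability of order \<open>1 / n\<close>.\<close>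
  define E where "E n = {\<omega>\<in>space M. \<exists>s\<in>S n. real n ^ (D + 1) \<le> (\<Prod>i=1..n. u n s (Xs i \<omega>) / f0 (Xs i \<omega>))}" for n
  \<comment> \<open>The net is controlled only for \<open>n \<ge> 1\<close>; at 0 the empty set
    serves as a measurable default.\<close>
  define B where "B n = (if n = 0 then {} else E n)" for n
  define \<gamma> where "\<gamma> = real (k + 1) * (\<integral>x. G x \<partial>\<mu>)"
  have \<gamma>: "\<gamma> \<ge> 0" unfolding \<gamma>_def using G_nonneg by (intro mult_nonneg_nonneg integral_nonneg_AE AE_I2) auto
  have E: "E n \<in> events \<and> prob (E n) \<le> C * exp \<gamma> / real n" if n: "n \<ge> 1" for n
  proof -
    note Sn = S(1)[OF n, THEN subsetD]
    have meas: "(\<lambda>x. u n s x / f0 x) \<in> borel_measurable \<mu>" if "s \<in> S n" for s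
      unfolding u_def
      using borel_measurable_integrable[OF bracket_integrable[OF Sn[OF that]]] by measurable
    have nn: "0 \<le> u n s x / f0 x" if "s \<in> S n" "x \<in> space \<mu>" for s x
      unfolding u_def using bracket_nonneg[OF Sn[OF that(1)] _ that(2)] f0_pos[OF that(2)] by simp
    have r: "(\<integral>\<^sup>+x. ennreal (f0 x * (u n s x / f0 x)) \<partial>\<mu>) \<le> ennreal (1 + \<gamma> / real n)" if s: "s \<in> S n" for s
    proof -
      have "(\<integral>\<^sup>+x. ennreal (f0 x * (u n s x / f0 x)) \<partial>\<mu>) = (\<integral>\<^sup>+x. ennreal (u n s x) \<partial>\<mu>)"
        using f0_pos by (intro nn_integral_cong) force
      also have "\<dots> = ennreal (\<integral>x. u n s x \<partial>\<mu>)"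
        unfolding u_def using bracket_nonneg[OF Sn[OF s]]
        by (intro nn_integral_eq_integral bracket_integrable Sn[OF s] AE_I2) simp
      finally show ?thesis
        unfolding u_def bracket_integral[OF Sn[OF s]] by (simp add: \<gamma>_def)
    qed
    have t: "real n ^ (D + 1) > 0" using n by simp
    have r0: "0 \<le> 1 + \<gamma> / real n" using \<gamma> by simp
    note * = prob_ex_prod_ge[where J = "S n" and g = "\<lambda>s x. u n s x / f0 x" and n = n, OF S(2)[OF n] meas nn r r0 t]
    have "(1 + \<gamma> / real n) ^ n \<le> exp (\<gamma> / real n) ^ n"
      using r0 by (intro power_mono) auto
    also have "\<dots> = exp \<gamma>" using n by (simp flip: exp_of_nat_mult)
    finally have "real (card (S n)) * (1 + \<gamma> / real n) ^ n / real n ^ (D + 1) \<le> (C * real n ^ D) * exp \<gamma> / real n ^ (D + 1)"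
      using r0 by (intro divide_right_mono mult_mono S(3) n) (auto intro: order_trans[OF _ S(3)[OF n]])
    also have "\<dots> = C * exp \<gamma> / real n" using n by simp
    finally have "real (card (S n)) * (1 + \<gamma> / real n) ^ n / real n ^ (D + 1) \<le> C * exp \<gamma> / real n" .
    then show ?thesis using * by (simp add: E_def del: power_Suc power.simps)
  qed
  show ?thesis
  proof (rule that)
    show "B n \<in> events" for n using E[of n] by (simp add: B_def)
    show "(\<lambda>n. prob (B n)) \<longlonglongrightarrow> 0"
    proof (rule tendsto_sandwich[OF _ _ tendsto_const])
      show "(\<lambda>n. C * exp \<gamma> / real n) \<longlonglongrightarrow> 0" by real_asymp
      show "\<forall>\<^sub>F n in sequentially. prob (B n) \<le> C * exp \<gamma> / real n"
        using eventually_ge_at_top[of 1] by eventually_elim (use E in \<open>auto simp: B_def\<close>)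
    qed auto
    fix n \<omega> \<psi> assume n: "n \<ge> 1" and \<omega>: "\<omega> \<in> space M - B n" and \<psi>: "\<psi> \<in> mixture_params T k"
    obtain s where s: "s \<in> S n" "close_params k (1 / real n) \<psi> s" using S(4)[OF n \<psi>] by blast
    have sp: "Xs i \<omega> \<in> space \<mu>" if "i \<in> {1..n}" for i using that \<omega> Xs_space by auto
    have "(\<Prod>i=1..n. u n s (Xs i \<omega>) / f0 (Xs i \<omega>)) < real n ^ (D + 1)"
      using \<omega> n s(1) by (force simp: B_def E_def not_le)
    then have "(\<Sum>i=1..n. ln (mixture \<phi> k \<psi> (Xs i \<omega>))) \<le> (\<Sum>i=1..n. ln (f0 (Xs i \<omega>))) + ln (real n ^ (D + 1))"
      by (intro sum_ln_le_of_prod_less)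
         (auto simp: u_def intro!: mixture_positive[OF \<psi>] f0_pos sp mixture_le_bracket[OF \<psi> _ s(2)] S(1)[OF n, THEN subsetD, OF s(1)])
    then show "(\<Sum>i=1..n. ln (mixture \<phi> k \<psi> (Xs i \<omega>))) \<le> (\<Sum>i=1..n. ln (f0 (Xs i \<omega>))) + real (D + 1) * ln (real n)"
      using n by (simp add: ln_realpow del: power_Suc)
  qed
qed

section \<open>Likelihood ratios of too small models decay exponentially\<close>

text \<open>Subadditivity of the square root bounds the affinity of the bracket by
  \<open>A + \<eta> * H\<close>, where \<open>A < 1\<close> is the affinity of the mixture itself. A
  small \<open>\<eta>\<close> therefore keeps it below 1.\<close>

lemma bracket_affinity:
  assumes \<psi>: "\<psi> \<in> mixture_params T k" and neq: "\<not> (AE x in \<mu>. f0 x = mixture \<phi> k \<psi> x)"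
  obtains \<delta> where "\<delta> > 0" "integrable \<mu> (\<lambda>x. sqrt (bracket k \<delta> \<psi> x * f0 x))"
    "(\<integral>x. sqrt (bracket k \<delta> \<psi> x * f0 x) \<partial>\<mu>) < 1"
proof -
  define A where "A = (\<integral>x. sqrt (mixture \<phi> k \<psi> x * f0 x) \<partial>\<mu>)"
  define H where "H = (\<integral>x. sqrt (G x * f0 x) \<partial>\<mu>)"
  note f0_nn = less_imp_le[OF f0_pos] and mix_nn = less_imp_le[OF mixture_positive[OF \<psi>]]
  have "\<not> (AE x in \<mu>. mixture \<phi> k \<psi> x = f0 x)"
    using neq by (auto simp: eq_commute)
  then have A: "A < 1"
    unfolding A_def
    by (intro affinity_less_one mixture_integrable mixture_integral integrable_f0 integral_f0 \<psi> f0_nn mix_nn)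
  have H: "H \<ge> 0"
    unfolding H_def using G_nonneg f0_nn by (intro integral_nonneg_AE AE_I2) simp
  \<comment> \<open>This choice gives \<open>\<eta> * H \<le> (1 - A) / 2\<close>; the summand 1
    avoids division by zero. Below, \<open>\<delta>\<close> is such that the bracket adds exactly
    \<open>\<eta>\<^sup>2 * G\<close>, whose root is linear in \<open>\<eta>\<close>.\<close>
  define \<eta> where "\<eta> = (1 - A) / (2 * (H + 1))"
  define \<delta> where "\<delta> = \<eta>\<^sup>2 / real (k + 1)"
  have \<eta>: "\<eta> > 0" using A H by (simp add: \<eta>_def)
  then have \<delta>: "\<delta> > 0" by (simp add: \<delta>_def)
  have br: "bracket k \<delta> \<psi> x = mixture \<phi> k \<psi> x + \<eta>\<^sup>2 * G x" for x
    by (simp add: bracket_def \<delta>_def)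
  have int1: "integrable \<mu> (\<lambda>x. sqrt (mixture \<phi> k \<psi> x * f0 x))"
    by (intro integrable_sqrt_mult mixture_integrable \<psi> integrable_f0 f0_nn mix_nn)
  have int2: "integrable \<mu> (\<lambda>x. sqrt (G x * f0 x))"
    by (intro integrable_sqrt_mult G_int integrable_f0 f0_nn G_nonneg)
  have int: "integrable \<mu> (\<lambda>x. sqrt (bracket k \<delta> \<psi> x * f0 x))"
    using \<delta> by (intro integrable_sqrt_mult bracket_integrable \<psi> integrable_f0 f0_nn bracket_nonneg) auto
  have "(\<integral>x. sqrt (bracket k \<delta> \<psi> x * f0 x) \<partial>\<mu>) \<le>
      (\<integral>x. sqrt (mixture \<phi> k \<psi> x * f0 x) + \<eta> * sqrt (G x * f0 x) \<partial>\<mu>)"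
  proof (rule integral_mono[OF int])
    show "integrable \<mu> (\<lambda>x. sqrt (mixture \<phi> k \<psi> x * f0 x) + \<eta> * sqrt (G x * f0 x))"
      using int1 int2 by auto
    fix x assume x: "x \<in> space \<mu>"
    have "sqrt (mixture \<phi> k \<psi> x * f0 x + \<eta>\<^sup>2 * (G x * f0 x)) \<le>
        sqrt (mixture \<phi> k \<psi> x * f0 x) + sqrt (\<eta>\<^sup>2 * (G x * f0 x))"
      using f0_nn[OF x] mix_nn[OF x] G_nonneg[OF x] by (intro sqrt_add_le_add_sqrt) auto
    then show "sqrt (bracket k \<delta> \<psi> x * f0 x) \<le> sqrt (mixture \<phi> k \<psi> x * f0 x) + \<eta> * sqrt (G x * f0 x)"
      using \<eta> unfolding br by (simp add: algebra_simps real_sqrt_mult)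
  qed
  also have "\<dots> = A + \<eta> * H"
    using int1 int2 by (simp add: A_def H_def)
  also have "\<dots> < 1"
  proof -
    have "\<eta> * H \<le> \<eta> * (H + 1)" using \<eta> by simp
    also have "\<dots> = (1 - A) / 2"
    proof -
      have "(1 - A) / (2 * h) * h = (1 - A) / 2" if "h > 0" for h using that by simp
      from this[of "H + 1"] show ?thesis using H unfolding \<eta>_def by linarith
    qed
    finally show ?thesis using A by simp
  qed
  finally show ?thesis using that[OF \<delta> int] by simp
qed

text \<open>A finite subcover yields a fixed number of brackets whose affinities are at most some
  \<open>r < 1\<close>. The expected product of root ratios is then at most \<open>r ^ n\<close>.
  Markov's inequality at the threshold \<open>t ^ n\<close> with \<open>r = t * t\<close> leaves
  probability at most \<open>card J * t ^ n\<close>. Off that event the likelihood ratio is below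
  \<open>r ^ n\<close>, which gives \<open>c = - 2 * ln t\<close>.\<close>

lemma underfit:
  assumes "f0 \<notin> mixture_class \<mu> T \<phi> k"
  obtains c B where "c > 0" "\<And>n. B n \<in> events" "(\<lambda>n. prob (B n)) \<longlonglongrightarrow> 0"
    "\<And>n \<omega> \<psi>. \<omega> \<in> space M - B n \<Longrightarrow> \<psi> \<in> mixture_params T k \<Longrightarrow>
      (\<Sum>i=1..n. ln (mixture \<phi> k \<psi> (Xs i \<omega>))) \<le> (\<Sum>i=1..n. ln (f0 (Xs i \<omega>))) - c * real n"
proof -
  let ?P = "mixture_params T k"
  have neq: "\<not> (AE x in \<mu>. f0 x = mixture \<phi> k \<psi> x)" if "\<psi> \<in> ?P" for \<psi>
    using assms that by (auto simp: mixture_class_def)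
  have "\<forall>\<psi>\<in>?P. \<exists>\<delta>>0. integrable \<mu> (\<lambda>x. sqrt (bracket k \<delta> \<psi> x * f0 x)) \<and>
      (\<integral>x. sqrt (bracket k \<delta> \<psi> x * f0 x) \<partial>\<mu>) < 1"
  proof
    fix \<psi> assume \<psi>: "\<psi> \<in> ?P"
    show "\<exists>\<delta>>0. integrable \<mu> (\<lambda>x. sqrt (bracket k \<delta> \<psi> x * f0 x)) \<and>
        (\<integral>x. sqrt (bracket k \<delta> \<psi> x * f0 x) \<partial>\<mu>) < 1"
      by (rule bracket_affinity[OF \<psi> neq[OF \<psi>]]) auto
  qed
  from bchoice[OF this] obtain \<delta> where \<delta>: "\<And>\<psi>. \<psi> \<in> ?P \<Longrightarrow> \<delta> \<psi> > 0"
      "\<And>\<psi>. \<psi> \<in> ?P \<Longrightarrow> integrable \<mu> (\<lambda>x. sqrt (bracket k (\<delta> \<psi>) \<psi> x * f0 x))"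
      "\<And>\<psi>. \<psi> \<in> ?P \<Longrightarrow> (\<integral>x. sqrt (bracket k (\<delta> \<psi>) \<psi> x * f0 x) \<partial>\<mu>) < 1"
    by blast
  have "\<forall>\<psi>\<in>?P. \<exists>U. open U \<and> \<psi> \<in> U \<and> (\<forall>\<psi>'\<in>U. close_params k (\<delta> \<psi>) \<psi>' \<psi>)"
  proof
    fix \<psi> assume \<psi>: "\<psi> \<in> ?P"
    show "\<exists>U. open U \<and> \<psi> \<in> U \<and> (\<forall>\<psi>'\<in>U. close_params k (\<delta> \<psi>) \<psi>' \<psi>)"
      by (rule open_close_params[where \<psi> = \<psi> and k = k, OF \<delta>(1)[OF \<psi>]]) blast
  qed
  from bchoice[OF this] obtain U where U: "\<And>\<psi>. \<psi> \<in> ?P \<Longrightarrow> open (U \<psi>)" "\<And>\<psi>. \<psi> \<in> ?P \<Longrightarrow> \<psi> \<in> U \<psi>"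
      "\<And>\<psi> \<psi>'. \<psi> \<in> ?P \<Longrightarrow> \<psi>' \<in> U \<psi> \<Longrightarrow> close_params k (\<delta> \<psi>) \<psi>' \<psi>"
    by blast
  obtain J where J: "J \<subseteq> ?P" "finite J" "?P \<subseteq> (\<Union>\<psi>\<in>J. U \<psi>)"
    using compactE_image[OF compact_mixture_params[OF T_compact, of k], of ?P U] U(1,2) by blast
  define u where "u s = bracket k (\<delta> s) s" for s
  \<comment> \<open>The value \<open>1 / 4\<close> keeps \<open>R\<close> nonempty even if
    \<open>J\<close> is empty, and makes \<open>r\<close> positive so that its logarithm can be
    used.\<close>
  define R where "R = insert (1 / 4) ((\<lambda>s. \<integral>x. sqrt (u s x * f0 x) \<partial>\<mu>) ` J)"
  define r where "r = Max R"
  define t where "t = sqrt r"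
  have finR: "finite R" using J(2) by (simp add: R_def)
  have r: "1 / 4 \<le> r" "r < 1" "\<And>s. s \<in> J \<Longrightarrow> (\<integral>x. sqrt (u s x * f0 x) \<partial>\<mu>) \<le> r"
  proof -
    show "1 / 4 \<le> r" unfolding r_def by (rule Max_ge[OF finR]) (simp add: R_def)
    show "r < 1" unfolding r_def using finR J(1) \<delta>(3) by (subst Max_less_iff) (auto simp: R_def u_def)
    show "(\<integral>x. sqrt (u s x * f0 x) \<partial>\<mu>) \<le> r" if "s \<in> J" for s
      unfolding r_def by (rule Max_ge[OF finR]) (use that in \<open>auto simp: R_def\<close>)
  qed
  have t: "0 < t" "t < 1" "r = t * t" using r(1,2) by (auto simp: t_def)
  define B where "B n = {\<omega>\<in>space M. \<exists>s\<in>J. t ^ n \<le> (\<Prod>i=1..n. sqrt (u s (Xs i \<omega>) / f0 (Xs i \<omega>)))}" for n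
  have meas: "(\<lambda>x. sqrt (u s x / f0 x)) \<in> borel_measurable \<mu>" if "s \<in> J" for s
    unfolding u_def
    using borel_measurable_integrable[OF bracket_integrable[OF J(1)[THEN subsetD, OF that]]] by measurable
  have u_nn: "0 \<le> u s x" if "s \<in> J" "x \<in> space \<mu>" for s x
    unfolding u_def using J(1) that \<delta>(1)[of s] by (intro bracket_nonneg) (auto simp: less_imp_le)
  have nn: "0 \<le> sqrt (u s x / f0 x)" if "s \<in> J" "x \<in> space \<mu>" for s x
    using u_nn[OF that] f0_pos[OF that(2)] by simp
  \<comment> \<open>Under the density \<open>f0\<close>, the expectation of the root of the ratio
    \<open>u / f0\<close> is the affinity of \<open>u\<close> and \<open>f0\<close>.\<close>
  have I: "(\<integral>\<^sup>+x. ennreal (f0 x * sqrt (u s x / f0 x)) \<partial>\<mu>) \<le> ennreal r" if s: "s \<in> J" for s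
  proof -
    have "f0 x * sqrt (u s x / f0 x) = sqrt (u s x * f0 x)" if "x \<in> space \<mu>" for x
    proof -
      have "f0 x = sqrt (f0 x) * sqrt (f0 x)" using f0_pos[OF that] by simp
      then show ?thesis
        using f0_pos[OF that] by (simp add: real_sqrt_divide real_sqrt_mult field_simps)
    qed
    then have "(\<integral>\<^sup>+x. ennreal (f0 x * sqrt (u s x / f0 x)) \<partial>\<mu>) = (\<integral>\<^sup>+x. ennreal (sqrt (u s x * f0 x)) \<partial>\<mu>)"
      by (intro nn_integral_cong) simp
    also have "\<dots> = ennreal (\<integral>x. sqrt (u s x * f0 x) \<partial>\<mu>)"
      using \<delta>(2)[OF subsetD[OF J(1) s]] u_nn[OF s] f0_pos
      by (intro nn_integral_eq_integral AE_I2) (auto simp: u_def less_imp_le)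
    finally show ?thesis using r(3)[OF s] by (simp add: ennreal_leI)
  qed
  have r0: "r \<ge> 0" using r(1) by simp
  have B: "B n \<in> events" "prob (B n) \<le> real (card J) * r ^ n / t ^ n" for n
    unfolding B_def
    by (rule prob_ex_prod_ge[where g = "\<lambda>s x. sqrt (u s x / f0 x)", OF J(2) meas nn I r0 zero_less_power[OF t(1)]];
        assumption)+
  show ?thesis
  proof (rule that)
    show "- 2 * ln t > 0" using t by simp
    show "B n \<in> events" for n by (rule B)
    show "(\<lambda>n. prob (B n)) \<longlonglongrightarrow> 0"
    proof (rule tendsto_sandwich[OF _ _ tendsto_const])
      have "(\<lambda>n. real (card J) * t ^ n) \<longlonglongrightarrow> real (card J) * 0"
        using t by (intro tendsto_mult tendsto_const LIMSEQ_realpow_zero) auto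
      then show "(\<lambda>n. real (card J) * t ^ n) \<longlonglongrightarrow> 0" by simp
      show "\<forall>\<^sub>F n in sequentially. prob (B n) \<le> real (card J) * t ^ n"
        using B(2) t(1) by (intro always_eventually allI) (simp add: t(3) power_mult_distrib)
    qed auto
    fix n \<omega> \<psi> assume \<omega>: "\<omega> \<in> space M - B n" and \<psi>: "\<psi> \<in> ?P"
    obtain s where s: "s \<in> J" "\<psi> \<in> U s" using J(3) \<psi> by blast
    then have sP: "s \<in> ?P" using J(1) by blast
    have sp: "Xs i \<omega> \<in> space \<mu>" if "i \<in> {1..n}" for i using that \<omega> Xs_space by auto
    have "(\<Prod>i=1..n. sqrt (u s (Xs i \<omega>) / f0 (Xs i \<omega>))) < t ^ n"
      using \<omega> s(1) by (force simp: B_def not_le)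
    moreover have "(\<Prod>i=1..n. sqrt (u s (Xs i \<omega>) / f0 (Xs i \<omega>))) = sqrt (\<Prod>i=1..n. u s (Xs i \<omega>) / f0 (Xs i \<omega>))"
      by (rule prod_sqrt)
    moreover have "t ^ n = sqrt (r ^ n)" by (simp add: t_def real_sqrt_power)
    ultimately have "(\<Prod>i=1..n. u s (Xs i \<omega>) / f0 (Xs i \<omega>)) < r ^ n" by simp
    then have "(\<Sum>i=1..n. ln (mixture \<phi> k \<psi> (Xs i \<omega>))) \<le> (\<Sum>i=1..n. ln (f0 (Xs i \<omega>))) + ln (r ^ n)"
      by (intro sum_ln_le_of_prod_less)
         (auto simp: u_def intro!: mixture_positive[OF \<psi>] f0_pos sp mixture_le_bracket[OF \<psi> sP U(3)[OF sP s(2)]])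
    then show "(\<Sum>i=1..n. ln (mixture \<phi> k \<psi> (Xs i \<omega>))) \<le> (\<Sum>i=1..n. ln (f0 (Xs i \<omega>))) - (- 2 * ln t) * real n"
      using t by (simp add: t(3) ln_realpow ln_mult mult_ac)
  qed
qed

end

section \<open>Selection by penalised minima, and its measurability\<close>

lemma order_estimator_eqI:
  assumes "k0 \<in> {1..K}"
    and "\<And>k. k \<in> {1..K} \<Longrightarrow> k \<noteq> k0 \<Longrightarrow>
      min_neg_loglik T \<phi> k0 n xs + pen k0 < min_neg_loglik T \<phi> k n xs + pen k"
  shows "order_estimator T \<phi> K pen n xs = k0"
proof -
  let ?f = "\<lambda>k. min_neg_loglik T \<phi> k n xs + pen k"
  have "is_arg_min ?f (\<lambda>k. k \<in> {1..K}) k \<longleftrightarrow> k = k0" for k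
  proof
    assume k: "is_arg_min ?f (\<lambda>k. k \<in> {1..K}) k"
    then have "k \<in> {1..K}" "\<not> ?f k0 < ?f k"
      using assms(1) by (auto simp: is_arg_min_def)
    then show "k = k0" using assms(2) by blast
  next
    have "\<not> ?f k < ?f k0" if "k \<in> {1..K}" for k
      using assms(2)[OF that] by (cases "k = k0") auto
    moreover assume "k = k0"
    ultimately show "is_arg_min ?f (\<lambda>k. k \<in> {1..K}) k"
      using assms(1) by (simp add: is_arg_min_def)
  qed
  then have "{k. is_arg_min ?f (\<lambda>k. k \<in> {1..K}) k} = {k0}" by blast
  then show ?thesis by (simp add: order_estimator_def)
qed

text \<open>The least minimiser is an optimal index with no optimal index before it. This writes the
  event as a finite Boolean combination of inequalities between penalised minima, from which its
  measurability follows.\<close>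

lemma order_estimator_eq_iff:
  fixes pen :: "nat \<Rightarrow> real"
  fixes T \<phi> n xs
  assumes "k0 \<in> {1..K}"
  defines "opt k \<equiv> \<forall>j\<in>{1..K}. min_neg_loglik T \<phi> k n xs + pen k \<le> min_neg_loglik T \<phi> j n xs + pen j"
  shows "order_estimator T \<phi> K pen n xs = k0 \<longleftrightarrow> opt k0 \<and> (\<forall>k\<in>{1..<k0}. \<not> opt k)"
proof -
  let ?f = "\<lambda>k. min_neg_loglik T \<phi> k n xs + pen k"
  let ?A = "{k. is_arg_min ?f (\<lambda>k. k \<in> {1..K}) k}"
  have A: "k \<in> ?A \<longleftrightarrow> k \<in> {1..K} \<and> opt k" for k
    unfolding is_arg_min_def opt_def mem_Collect_eq by (auto simp: not_less)
  have sub: "?A \<subseteq> {1..K}" using A by blast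
  then have "finite ?A" by (rule finite_subset) simp
  moreover have "?A \<noteq> {}"
    using ex_is_arg_min_if_finite[of "{1..K}" ?f] assms(1) by auto
  ultimately have "Min ?A = k0 \<longleftrightarrow> k0 \<in> ?A \<and> (\<forall>a\<in>?A. k0 \<le> a)" by (rule Min_eq_iff)
  also have "\<dots> \<longleftrightarrow> opt k0 \<and> (\<forall>k\<in>{1..<k0}. \<not> opt k)"
  proof -
    have "(\<forall>a\<in>?A. k0 \<le> a) \<longleftrightarrow> (\<forall>k\<in>{1..<k0}. \<not> opt k)"
      unfolding Ball_def A using assms(1) by (meson atLeastAtMost_iff atLeastLessThan_iff less_imp_le_nat not_le order_trans)
    then show ?thesis using A[of k0] assms(1) by blast
  qed
  finally show ?thesis unfolding order_estimator_def .
qed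

context iid_mixture
begin

lemma continuous_on_neg_loglik:
  assumes "\<And>i. i \<in> {1..n} \<Longrightarrow> xs i \<in> space \<mu>"
  shows "continuous_on (mixture_params T k) (neg_loglik \<phi> k n xs)"
  unfolding neg_loglik_def[abs_def]
proof (intro continuous_on_mult continuous_on_const continuous_on_sum continuous_on_ln ballI)
  fix i assume i: "i \<in> {1..n}"
  show "continuous_on (mixture_params T k) (\<lambda>\<psi>. mixture \<phi> k \<psi> (xs i))"
    by (rule continuous_on_mixture[where \<phi> = \<phi> and x = "xs i", OF \<phi>_cont[OF assms[OF i]]])
  show "mixture \<phi> k \<psi> (xs i) \<noteq> 0" if "\<psi> \<in> mixture_params T k" for \<psi>
    using mixture_positive[OF that assms[OF i]] by simp
qed

text \<open>\<open>min_neg_loglik\<close> is a \<open>LEAST\<close> over reals, which says nothing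
  until a minimiser is known to exist. Continuity on the compact parameter set provides one.\<close>

lemma min_neg_loglik_attained:
  assumes "k \<ge> 1" "\<And>i. i \<in> {1..n} \<Longrightarrow> xs i \<in> space \<mu>"
  shows "\<exists>\<psi>\<in>mixture_params T k. min_neg_loglik T \<phi> k n xs = neg_loglik \<phi> k n xs \<psi>"
    and "\<psi> \<in> mixture_params T k \<Longrightarrow> min_neg_loglik T \<phi> k n xs \<le> neg_loglik \<phi> k n xs \<psi>"
proof -
  have ne: "mixture_params T k \<noteq> {}"
  proof -
    obtain t where "t \<in> T" using T_nonempty by blast
    then show ?thesis by (rule mixture_params_nonempty[OF _ assms(1)])
  qed
  have cont: "continuous_on (mixture_params T k) (neg_loglik \<phi> k n xs)"
    by (rule continuous_on_neg_loglik) (rule assms(2))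
  obtain \<psi>0 where \<psi>0: "\<psi>0 \<in> mixture_params T k"
      "\<forall>\<psi>\<in>mixture_params T k. neg_loglik \<phi> k n xs \<psi>0 \<le> neg_loglik \<phi> k n xs \<psi>"
    using continuous_attains_inf[OF compact_mixture_params[OF T_compact] ne cont] by (elim bexE)
  have eq: "min_neg_loglik T \<phi> k n xs = neg_loglik \<phi> k n xs \<psi>0"
    unfolding min_neg_loglik_def
  proof (rule Least_equality)
    show "neg_loglik \<phi> k n xs \<psi>0 \<in> neg_loglik \<phi> k n xs ` mixture_params T k"
      using \<psi>0(1) by (rule imageI)
    show "neg_loglik \<phi> k n xs \<psi>0 \<le> v" if "v \<in> neg_loglik \<phi> k n xs ` mixture_params T k" for v
      using that \<psi>0(2) by (elim imageE) simp
  qed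
  show "\<exists>\<psi>\<in>mixture_params T k. min_neg_loglik T \<phi> k n xs = neg_loglik \<phi> k n xs \<psi>"
    using eq \<psi>0(1) by (rule bexI)
  show "min_neg_loglik T \<phi> k n xs \<le> neg_loglik \<phi> k n xs \<psi>" if "\<psi> \<in> mixture_params T k"
    unfolding eq using \<psi>0(2) that by (rule bspec)
qed

text \<open>The minimum runs over an uncountable set, but by continuity it is at least
  \<open>a\<close> as soon as the values on a countable dense subset are. Each such condition is a
  countable intersection of events.\<close>

lemma min_neg_loglik_measurable:
  assumes "k \<ge> 1"
  shows "(\<lambda>\<omega>. min_neg_loglik T \<phi> k n (\<lambda>i. Xs i \<omega>)) \<in> borel_measurable M"
proof -
  let ?P = "mixture_params T k"
  obtain D where D: "countable D" "D \<subseteq> ?P" "?P \<subseteq> closure D" by (rule separable)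
  have "closure D \<subseteq> ?P"
    using D(2) compact_imp_closed[OF compact_mixture_params[OF T_compact]] by (rule closure_minimal)
  with D(3) have cl: "closure D = ?P" by blast
  have sp: "Xs i \<omega> \<in> space \<mu>" if "\<omega> \<in> space M" "i \<in> {1..n}" for i \<omega> using that Xs_space by auto
  have meas: "(\<lambda>\<omega>. neg_loglik \<phi> k n (\<lambda>i. Xs i \<omega>) \<psi>) \<in> borel_measurable M" if "\<psi> \<in> ?P" for \<psi>
    unfolding neg_loglik_def
    by (intro borel_measurable_times borel_measurable_const borel_measurable_sum borel_measurable_ln)
       (rule measurable_compose[OF Xs_measurable mixture_measurable[OF that]], simp)
  have "{\<omega>\<in>space M. a \<le> min_neg_loglik T \<phi> k n (\<lambda>i. Xs i \<omega>)} \<in> events" for a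
  proof -
    have "a \<le> min_neg_loglik T \<phi> k n (\<lambda>i. Xs i \<omega>) \<longleftrightarrow> (\<forall>\<psi>\<in>D. a \<le> neg_loglik \<phi> k n (\<lambda>i. Xs i \<omega>) \<psi>)"
      if \<omega>: "\<omega> \<in> space M" for \<omega>
    proof
      assume a: "a \<le> min_neg_loglik T \<phi> k n (\<lambda>i. Xs i \<omega>)"
      show "\<forall>\<psi>\<in>D. a \<le> neg_loglik \<phi> k n (\<lambda>i. Xs i \<omega>) \<psi>"
      proof
        fix \<psi> assume "\<psi> \<in> D"
        then have "\<psi> \<in> ?P" using D(2) by (rule rev_subsetD)
        then show "a \<le> neg_loglik \<phi> k n (\<lambda>i. Xs i \<omega>) \<psi>"
          using a min_neg_loglik_attained(2)[where xs = "\<lambda>i. Xs i \<omega>", OF assms sp[OF \<omega>]]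
          by (meson order_trans)
      qed
    next
      assume le: "\<forall>\<psi>\<in>D. a \<le> neg_loglik \<phi> k n (\<lambda>i. Xs i \<omega>) \<psi>"
      obtain \<psi> where \<psi>: "\<psi> \<in> ?P" "min_neg_loglik T \<phi> k n (\<lambda>i. Xs i \<omega>) = neg_loglik \<phi> k n (\<lambda>i. Xs i \<omega>) \<psi>"
        using min_neg_loglik_attained(1)[where xs = "\<lambda>i. Xs i \<omega>", OF assms sp[OF \<omega>]] by blast
      have "a \<le> neg_loglik \<phi> k n (\<lambda>i. Xs i \<omega>) \<psi>"
        by (rule continuous_ge_on_closure[where f = "neg_loglik \<phi> k n (\<lambda>i. Xs i \<omega>)"])
           (use cl \<psi>(1) le continuous_on_neg_loglik[where xs = "\<lambda>i. Xs i \<omega>", OF sp[OF \<omega>]] in auto)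
      with \<psi>(2) show "a \<le> min_neg_loglik T \<phi> k n (\<lambda>i. Xs i \<omega>)" by simp
    qed
    then have "{\<omega>\<in>space M. a \<le> min_neg_loglik T \<phi> k n (\<lambda>i. Xs i \<omega>)} =
        {\<omega>\<in>space M. \<forall>\<psi>\<in>D. a \<le> neg_loglik \<phi> k n (\<lambda>i. Xs i \<omega>) \<psi>}"
      by (intro Collect_cong conj_cong refl)
    also have "\<dots> = space M - (\<Union>\<psi>\<in>D. {\<omega>\<in>space M. neg_loglik \<phi> k n (\<lambda>i. Xs i \<omega>) \<psi> < a})"
      unfolding not_less[symmetric] by blast
    also have "\<dots> \<in> events"
    proof (intro sets.compl_sets sets.countable_UN''[OF D(1)])
      show "{\<omega>\<in>space M. neg_loglik \<phi> k n (\<lambda>i. Xs i \<omega>) \<psi> < a} \<in> events" if "\<psi> \<in> D" for \<psi>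
        using meas[OF subsetD[OF D(2) that]] borel_measurable_const by (rule borel_measurable_less)
    qed
    finally show ?thesis .
  qed
  then show ?thesis unfolding borel_measurable_iff_ge by (intro allI)
qed

text \<open>A set that is not an event has measure 0 by convention, so a lower bound on its
  probability requires measurability.\<close>

lemma order_estimator_event:
  assumes "k0 \<in> {1..K}"
  shows "{\<omega>\<in>space M. order_estimator T \<phi> K pen n (\<lambda>i. Xs i \<omega>) = k0} \<in> events"
proof -
  have pred: "Measurable.pred M (\<lambda>\<omega>. min_neg_loglik T \<phi> k n (\<lambda>i. Xs i \<omega>) + pen k
      \<le> min_neg_loglik T \<phi> j n (\<lambda>i. Xs i \<omega>) + pen j)" if "k \<ge> 1" "j \<ge> 1" for k j
    unfolding pred_def
    by (intro borel_measurable_le borel_measurable_add borel_measurable_const min_neg_loglik_measurable that)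
  have opt: "Measurable.pred M (\<lambda>\<omega>. \<forall>j\<in>{1..K}. min_neg_loglik T \<phi> k n (\<lambda>i. Xs i \<omega>) + pen k
      \<le> min_neg_loglik T \<phi> j n (\<lambda>i. Xs i \<omega>) + pen j)" if "k \<ge> 1" for k
    by (rule pred_intros_countable_bounded(3), rule pred) (use that in auto)
  have "Measurable.pred M (\<lambda>\<omega>. \<forall>k\<in>{1..<k0}. \<not> (\<forall>j\<in>{1..K}. min_neg_loglik T \<phi> k n (\<lambda>i. Xs i \<omega>) + pen k
      \<le> min_neg_loglik T \<phi> j n (\<lambda>i. Xs i \<omega>) + pen j))"
    by (rule pred_intros_countable_bounded(3), rule pred_intros_logic(2), rule opt) auto
  then show ?thesis
    unfolding order_estimator_eq_iff[OF assms]
    by (intro predE pred_intros_logic(3) opt) (use assms in auto)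
qed

section \<open>Consistency for a general penalty rate\<close>

text \<open>The best mixture of order \<open>k0\<close> fits at least as well as
  \<open>\<psi>0\<close>, which reproduces \<open>f0\<close> on the sample, while the minimiser of
  order \<open>k\<close> beats \<open>f0\<close> by at most \<open>d\<close>. The number
  \<open>d\<close> is negative in the underfitting case.\<close>

lemma min_neg_loglik_diff_ge:
  assumes k: "k \<ge> 1" "k0 \<ge> 1" and n: "n \<ge> 1" and \<omega>: "\<omega> \<in> space M"
    and \<psi>0: "\<psi>0 \<in> mixture_params T k0" "\<And>i. i \<ge> 1 \<Longrightarrow> f0 (Xs i \<omega>) = mixture \<phi> k0 \<psi>0 (Xs i \<omega>)"
    and le: "\<And>\<psi>. \<psi> \<in> mixture_params T k \<Longrightarrow>
      (\<Sum>i=1..n. ln (mixture \<phi> k \<psi> (Xs i \<omega>))) \<le> (\<Sum>i=1..n. ln (f0 (Xs i \<omega>))) + d"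
  shows "min_neg_loglik T \<phi> k0 n (\<lambda>i. Xs i \<omega>) - d / real n \<le> min_neg_loglik T \<phi> k n (\<lambda>i. Xs i \<omega>)"
proof -
  let ?xs = "\<lambda>i. Xs i \<omega>"
  have sp: "?xs i \<in> space \<mu>" if "i \<in> {1..n}" for i using that \<omega> Xs_space by auto
  obtain \<psi> where \<psi>: "\<psi> \<in> mixture_params T k" "min_neg_loglik T \<phi> k n ?xs = neg_loglik \<phi> k n ?xs \<psi>"
    using min_neg_loglik_attained(1)[where xs = ?xs, OF k(1) sp] by blast
  have "min_neg_loglik T \<phi> k0 n ?xs \<le> neg_loglik \<phi> k0 n ?xs \<psi>0"
    by (rule min_neg_loglik_attained(2)[where xs = ?xs, OF k(2) sp \<psi>0(1)])
  also have "\<dots> = - (1 / real n) * (\<Sum>i=1..n. ln (f0 (Xs i \<omega>)))"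
    unfolding neg_loglik_def using \<psi>0(2) by simp
  also have "\<dots> \<le> - (1 / real n) * ((\<Sum>i=1..n. ln (mixture \<phi> k \<psi> (Xs i \<omega>))) - d)"
    using le[OF \<psi>(1)] n by (intro mult_left_mono_neg) auto
  also have "\<dots> = neg_loglik \<phi> k n ?xs \<psi> + d / real n"
    unfolding neg_loglik_def by (simp add: algebra_simps diff_divide_distrib)
  finally show ?thesis unfolding \<psi>(2) by simp
qed

text \<open>The two rate conditions match the two errors. For \<open>k < k0\<close> the fit loses a
  constant per observation, which a penalty difference tending to 0 cannot offset. For
  \<open>k > k0\<close> the fit gains at most order \<open>ln n / n\<close>, which the penalty
  eventually exceeds.\<close>

lemma order_estimator_consistent:
  fixes \<alpha> :: "nat \<Rightarrow> real" and w :: "nat \<Rightarrow> real"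
  assumes k0: "k0 \<in> {1..K}"
    and f0: "f0 \<in> mixture_class \<mu> T \<phi> k0" "f0 \<notin> mixture_class \<mu> T \<phi> (k0 - 1)"
    and \<alpha>: "strict_mono_on {1..} \<alpha>"
    and w0: "w \<longlonglongrightarrow> 0" and w_top: "filterlim (\<lambda>n. w n * real n / ln (real n)) at_top sequentially"
  shows "(\<lambda>n. prob {\<omega>\<in>space M. order_estimator T \<phi> K (\<lambda>k. \<alpha> k * w n) n (\<lambda>i. Xs i \<omega>) = k0}) \<longlonglongrightarrow> 1"
proof -
  let ?m = "\<lambda>k n \<omega>. min_neg_loglik T \<phi> k n (\<lambda>i. Xs i \<omega>)"
  obtain \<psi>0 where \<psi>0: "\<psi>0 \<in> mixture_params T k0" "AE x in \<mu>. f0 x = mixture \<phi> k0 \<psi>0 x"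
    using f0(1) by (auto simp: mixture_class_def)
  \<comment> \<open>The density \<open>f0\<close> equals a mixture only \<open>\<mu>\<close>-almost
    everywhere; almost surely no sample point meets the exceptional set.\<close>
  define good where "good \<omega> \<longleftrightarrow> (\<forall>i\<ge>1. f0 (Xs i \<omega>) = mixture \<phi> k0 \<psi>0 (Xs i \<omega>))" for \<omega>
  have good: "AE \<omega> in M. good \<omega>" unfolding good_def by (rule AE_Xs[OF \<psi>0(2)])
  have diff: "?m k0 n \<omega> - d / real n \<le> ?m k n \<omega>"
    if "k \<ge> 1" "n \<ge> 1" "\<omega> \<in> space M" "good \<omega>" "\<And>\<psi>. \<psi> \<in> mixture_params T k \<Longrightarrow>
      (\<Sum>i=1..n. ln (mixture \<phi> k \<psi> (Xs i \<omega>))) \<le> (\<Sum>i=1..n. ln (f0 (Xs i \<omega>))) + d" for k n \<omega> d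
    by (rule min_neg_loglik_diff_ge[OF that(1) _ that(2,3) \<psi>0(1)])
       (use k0 that(4,5) in \<open>auto simp: good_def\<close>)
  define Ks where "Ks = {1..K} - {k0}"
  have "\<forall>k\<in>Ks. \<exists>B. (\<forall>n. B n \<in> events) \<and> (\<lambda>n. prob (B n)) \<longlonglongrightarrow> 0 \<and>
      (\<forall>\<^sub>F n in sequentially. \<forall>\<omega>\<in>space M - B n. good \<omega> \<longrightarrow> ?m k0 n \<omega> + \<alpha> k0 * w n < ?m k n \<omega> + \<alpha> k * w n)"
  proof
    fix k assume k: "k \<in> Ks"
    then have k1: "k \<ge> 1" by (simp add: Ks_def)
    consider "k < k0" | "k > k0" using k by (force simp: Ks_def)
    then show "\<exists>B. (\<forall>n. B n \<in> events) \<and> (\<lambda>n. prob (B n)) \<longlonglongrightarrow> 0 \<and>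
      (\<forall>\<^sub>F n in sequentially. \<forall>\<omega>\<in>space M - B n. good \<omega> \<longrightarrow> ?m k0 n \<omega> + \<alpha> k0 * w n < ?m k n \<omega> + \<alpha> k * w n)"
    proof cases
      case 1
      then have "k \<le> k0 - 1" by linarith
      then have "f0 \<notin> mixture_class \<mu> T \<phi> k"
        using f0(2) mixture_class_mono[OF k1] by blast
      then obtain c B where B: "c > 0" "\<And>n. B n \<in> events" "(\<lambda>n. prob (B n)) \<longlonglongrightarrow> 0"
        "\<And>n \<omega> \<psi>. \<omega> \<in> space M - B n \<Longrightarrow> \<psi> \<in> mixture_params T k \<Longrightarrow>
          (\<Sum>i=1..n. ln (mixture \<phi> k \<psi> (Xs i \<omega>))) \<le> (\<Sum>i=1..n. ln (f0 (Xs i \<omega>))) - c * real n"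
        by (rule underfit) blast
      have "(\<lambda>n. (\<alpha> k0 - \<alpha> k) * w n) \<longlonglongrightarrow> 0"
        using tendsto_mult_right_zero[OF w0] by simp
      then have "\<forall>\<^sub>F n in sequentially. (\<alpha> k0 - \<alpha> k) * w n < c"
        using B(1) by (rule order_tendstoD(2))
      then have ev: "\<forall>\<^sub>F n in sequentially. \<forall>\<omega>\<in>space M - B n. good \<omega> \<longrightarrow> ?m k0 n \<omega> + \<alpha> k0 * w n < ?m k n \<omega> + \<alpha> k * w n"
        using eventually_ge_at_top[of 1]
      proof eventually_elim
        case (elim n)
        show ?case
        proof (intro ballI impI)
          fix \<omega> assume \<omega>: "\<omega> \<in> space M - B n" "good \<omega>"
          \<comment> \<open>Here \<open>d\<close> is \<open>- (c * real n)\<close>, so division by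
            \<open>n\<close> leaves the constant gap \<open>c\<close>.\<close>
          have "?m k0 n \<omega> - (- (c * real n)) / real n \<le> ?m k n \<omega>"
            using B(4)[OF \<omega>(1)] \<omega> elim(2) k1 by (intro diff) auto
          then show "?m k0 n \<omega> + \<alpha> k0 * w n < ?m k n \<omega> + \<alpha> k * w n"
            using elim by (simp add: algebra_simps)
        qed
      qed
      show ?thesis by (intro exI[of _ B] conjI allI B(2,3) ev)
    next
      case 2
      obtain c B where B: "\<And>n. B n \<in> events" "(\<lambda>n. prob (B n)) \<longlonglongrightarrow> 0"
        "\<And>n \<omega> \<psi>. n \<ge> 1 \<Longrightarrow> \<omega> \<in> space M - B n \<Longrightarrow> \<psi> \<in> mixture_params T k \<Longrightarrow>
          (\<Sum>i=1..n. ln (mixture \<phi> k \<psi> (Xs i \<omega>))) \<le> (\<Sum>i=1..n. ln (f0 (Xs i \<omega>))) + c * ln (real n)"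
        by (rule overfit) blast
      have a: "\<alpha> k - \<alpha> k0 > 0"
        using strict_mono_onD[OF \<alpha>, of k0 k] 2 k0 by simp
      \<comment> \<open>The threshold is such that, multiplied by
        \<open>(\<alpha> k - \<alpha> k0) * ln n / n\<close>, it becomes the possible gain in
        fit.\<close>
      have "\<forall>\<^sub>F n in sequentially. c / (\<alpha> k - \<alpha> k0) < w n * real n / ln (real n)"
        using w_top by (simp add: filterlim_at_top_dense)
      then have ev: "\<forall>\<^sub>F n in sequentially. \<forall>\<omega>\<in>space M - B n. good \<omega> \<longrightarrow> ?m k0 n \<omega> + \<alpha> k0 * w n < ?m k n \<omega> + \<alpha> k * w n"
        using eventually_ge_at_top[of 2]
      proof eventually_elim
        case (elim n)
        have ln: "ln (real n) > 0" using elim(2) by simp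
        have "c * ln (real n) < (\<alpha> k - \<alpha> k0) * (w n * real n)"
          using elim(1) a ln by (simp add: field_simps)
        then have lt: "c * ln (real n) / real n < (\<alpha> k - \<alpha> k0) * w n"
          using elim(2) by (simp add: field_simps)
        show ?case
        proof (intro ballI impI)
          fix \<omega> assume \<omega>: "\<omega> \<in> space M - B n" "good \<omega>"
          have "?m k0 n \<omega> - c * ln (real n) / real n \<le> ?m k n \<omega>"
            using B(3)[OF _ \<omega>(1)] \<omega> elim(2) k1 by (intro diff) auto
          then show "?m k0 n \<omega> + \<alpha> k0 * w n < ?m k n \<omega> + \<alpha> k * w n"
            using lt by (simp add: algebra_simps)
        qed
      qed
      show ?thesis by (intro exI[of _ B] conjI allI B(1,2) ev)
    qed
  qed
  from bchoice[OF this] obtain B where B: "\<And>k n. k \<in> Ks \<Longrightarrow> B k n \<in> events"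
      "\<And>k. k \<in> Ks \<Longrightarrow> (\<lambda>n. prob (B k n)) \<longlonglongrightarrow> 0"
      "\<And>k. k \<in> Ks \<Longrightarrow> \<forall>\<^sub>F n in sequentially. \<forall>\<omega>\<in>space M - B k n. good \<omega> \<longrightarrow>
        ?m k0 n \<omega> + \<alpha> k0 * w n < ?m k n \<omega> + \<alpha> k * w n"
    by blast
  have finKs: "finite Ks" by (simp add: Ks_def)
  let ?E = "\<lambda>n. {\<omega>\<in>space M. order_estimator T \<phi> K (\<lambda>k. \<alpha> k * w n) n (\<lambda>i. Xs i \<omega>) = k0}"
  have "\<forall>\<^sub>F n in sequentially. \<forall>k\<in>Ks. \<forall>\<omega>\<in>space M - B k n. good \<omega> \<longrightarrow>
      ?m k0 n \<omega> + \<alpha> k0 * w n < ?m k n \<omega> + \<alpha> k * w n"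
    using B(3) finKs by (simp add: eventually_ball_finite_distrib)
  then have lower: "\<forall>\<^sub>F n in sequentially. 1 - (\<Sum>k\<in>Ks. prob (B k n)) \<le> prob (?E n)"
  proof eventually_elim
    case (elim n)
    note less = elim
    have U: "(\<Union>k\<in>Ks. B k n) \<in> events" using B(1) finKs by blast
    \<comment> \<open>The inclusion of events holds only where \<open>good\<close> does, hence
      monotonicity up to a null set.\<close>
    have "prob (space M - (\<Union>k\<in>Ks. B k n)) \<le> prob (?E n)"
    proof (rule finite_measure_mono_AE[OF _ order_estimator_event[OF k0]])
      show "AE \<omega> in M. \<omega> \<in> space M - (\<Union>k\<in>Ks. B k n) \<longrightarrow> \<omega> \<in> ?E n"
        using good
      proof eventually_elim
        case (elim \<omega>)
        show ?case
        proof
          assume \<omega>: "\<omega> \<in> space M - (\<Union>k\<in>Ks. B k n)"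
          have "order_estimator T \<phi> K (\<lambda>k. \<alpha> k * w n) n (\<lambda>i. Xs i \<omega>) = k0"
          proof (rule order_estimator_eqI[OF k0])
            fix k assume "k \<in> {1..K}" "k \<noteq> k0"
            then have "k \<in> Ks" by (simp add: Ks_def)
            then show "?m k0 n \<omega> + \<alpha> k0 * w n < ?m k n \<omega> + \<alpha> k * w n"
              using less[rule_format, of k \<omega>] \<omega> elim by blast
          qed
          then show "\<omega> \<in> ?E n" using \<omega> by simp
        qed
      qed
    qed
    moreover have "prob (\<Union>k\<in>Ks. B k n) \<le> (\<Sum>k\<in>Ks. prob (B k n))"
      using B(1) finKs by (intro finite_measure_subadditive_finite) auto
    ultimately show ?case using prob_compl[OF U] by simp
  qed
  have lim: "(\<lambda>n. 1 - (\<Sum>k\<in>Ks. prob (B k n))) \<longlonglongrightarrow> 1 - (\<Sum>k\<in>Ks. 0)"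
    by (intro tendsto_diff tendsto_const tendsto_sum B(2))
  show ?thesis
  proof (rule tendsto_sandwich[OF lower _ _ tendsto_const])
    show "\<forall>\<^sub>F n in sequentially. prob (?E n) \<le> 1" by (intro always_eventually allI prob_le_1)
    show "(\<lambda>n. 1 - (\<Sum>k\<in>Ks. prob (B k n))) \<longlonglongrightarrow> 1" using lim by simp
  qed
qed

end

section \<open>Growth rates of the two penalties\<close>

lemma Ln_filterlim: "filterlim Ln at_top at_top"
proof (rule filterlim_cong[THEN iffD1, OF refl refl _ ln_at_top])
  show "\<forall>\<^sub>F x in at_top. ln x = Ln x"
    using eventually_ge_at_top[of "exp 1"] by eventually_elim (simp add: Ln_def max_def)
qed

lemma Ln_iter_filterlim: "filterlim (Ln ^^ \<nu>) at_top at_top"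
proof (induction \<nu>)
  case 0
  then show ?case by (simp add: id_def filterlim_ident)
next
  case (Suc \<nu>)
  then show ?case using filterlim_compose[OF Ln_filterlim Suc] by (simp add: comp_def)
qed

text \<open>Each iterate eventually exceeds \<open>exp 1\<close>, where \<open>Ln\<close> is
  \<open>ln\<close>, and \<open>ln y \<le> y - 1\<close> shows that a further iteration only
  decreases the value.\<close>

lemma Ln_iter_le_ln:
  assumes "\<nu> \<ge> 1"
  shows "\<forall>\<^sub>F x in at_top. (Ln ^^ \<nu>) x \<le> ln x"
  using assms
proof (induction \<nu> rule: dec_induct)
  case base
  show ?case using eventually_ge_at_top[of "exp 1"] by eventually_elim (simp add: Ln_def max_def)
next
  case (step \<nu>)
  have "\<forall>\<^sub>F x in at_top. (Ln ^^ \<nu>) x \<ge> exp 1"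
    using Ln_iter_filterlim by (simp add: filterlim_at_top)
  with step.IH show ?case
  proof eventually_elim
    case (elim x)
    have pos: "0 < (Ln ^^ \<nu>) x" using elim(2) exp_gt_zero[of "1::real"] by linarith
    have "(Ln ^^ Suc \<nu>) x = ln ((Ln ^^ \<nu>) x)" using elim(2) by (simp add: Ln_def max_def)
    also have "\<dots> \<le> (Ln ^^ \<nu>) x" using ln_le_minus_one[OF pos] by simp
    finally show ?case using elim(1) by simp
  qed
qed


text \<open>The rate is squeezed between 0 and \<open>ln n * ln n / n\<close>. Multiplied by
  \<open>n / ln n\<close> it is the iterated logarithm itself, which diverges.\<close>

lemma nu_BIC_rate:
  assumes "\<nu> \<ge> 1"
  defines "w \<equiv> \<lambda>n. (Ln ^^ \<nu>) (real n) * ln (real n) / real n"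
  shows "w \<longlonglongrightarrow> 0" "filterlim (\<lambda>n. w n * real n / ln (real n)) at_top sequentially"
proof -
  have top: "filterlim (\<lambda>n. (Ln ^^ \<nu>) (real n)) at_top sequentially"
    by (rule filterlim_compose[OF Ln_iter_filterlim filterlim_real_sequentially])
  have le: "\<forall>\<^sub>F n in sequentially. (Ln ^^ \<nu>) (real n) \<le> ln (real n)"
    by (rule eventually_compose_filterlim[OF Ln_iter_le_ln[OF assms(1)] filterlim_real_sequentially])
  show "w \<longlonglongrightarrow> 0"
  proof (rule tendsto_sandwich[OF _ _ tendsto_const])
    show "(\<lambda>n. ln (real n) * ln (real n) / real n) \<longlonglongrightarrow> 0" by real_asymp
    show "\<forall>\<^sub>F n in sequentially. w n \<le> ln (real n) * ln (real n) / real n"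
      using le eventually_ge_at_top[of 1] unfolding w_def
      by eventually_elim (intro divide_right_mono mult_right_mono, auto)
    have "\<forall>\<^sub>F n in sequentially. 0 \<le> (Ln ^^ \<nu>) (real n)"
      using top by (simp add: filterlim_at_top)
    then show "\<forall>\<^sub>F n in sequentially. 0 \<le> w n"
      using eventually_ge_at_top[of 1] unfolding w_def by eventually_elim simp
  qed
  have "\<forall>\<^sub>F n in sequentially. (Ln ^^ \<nu>) (real n) = w n * real n / ln (real n)"
    using eventually_ge_at_top[of 2] unfolding w_def by eventually_elim simp
  then show "filterlim (\<lambda>n. w n * real n / ln (real n)) at_top sequentially"
    using top by (simp cong: filterlim_cong)
qed

lemma eps_BIC_rate:
  fixes \<epsilon> :: real
  assumes "\<epsilon> > 0"
  defines "w \<equiv> \<lambda>n. ln (real n) powr (1 + \<epsilon>) / real n"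
  shows "w \<longlonglongrightarrow> 0" "filterlim (\<lambda>n. w n * real n / ln (real n)) at_top sequentially"
  using assms(1) unfolding w_def by real_asymp+

section \<open>Consistency of the \<nu>-BIC and the \<epsilon>-BIC\<close>

theorem corollary9:
  fixes M :: "'w measure"
    and \<X> :: "'x::topological_space set"
    and \<mu> :: "'x measure"
    and X :: "'w \<Rightarrow> 'x"
    and Xs :: "nat \<Rightarrow> 'w \<Rightarrow> 'x"
    and f0 :: "'x \<Rightarrow> real"
    and T :: "(real ^ 'm) set"
    and \<phi> :: "'x \<Rightarrow> real ^ 'm \<Rightarrow> real"
    and G1 G2 L :: "'x \<Rightarrow> real"
    and K k0 \<nu> :: nat
    and \<alpha> :: "nat \<Rightarrow> real"
    and \<epsilon> :: real
  assumes prob: "prob_space M"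
    and base: "sets \<mu> = sets (restrict_space borel \<X>)"
    and f0_pos: "\<And>x. x \<in> \<X> \<Longrightarrow> f0 x > 0"
    and X_density: "distributed M \<mu> X (\<lambda>x. ennreal (f0 x))"
    and phi_density: "\<And>\<theta>. \<theta> \<in> T \<Longrightarrow> (\<integral>x. \<phi> x \<theta> \<partial>\<mu>) = 1"
    and A1_order: "k0 \<in> {1..K}"
    and A1_f0: "f0 \<in> mixture_class \<mu> T \<phi> k0 - mixture_class \<mu> T \<phi> (k0 - 1)"
    and A1_indep: "prob_space.indep_vars M (\<lambda>_. \<mu>) Xs {1..}"
    and A1_ident: "\<And>i. i \<ge> 1 \<Longrightarrow> distr M \<mu> (Xs i) = distr M \<mu> X"
    and A2_pos: "\<And>x \<theta>. x \<in> \<X> \<Longrightarrow> \<theta> \<in> T \<Longrightarrow> \<phi> x \<theta> > 0"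
    and A2_compact: "compact T"
    and A3_cont: "\<And>x. x \<in> \<X> \<Longrightarrow> continuous_on T (\<phi> x)"
    and A3_meas: "\<And>\<theta>. \<theta> \<in> T \<Longrightarrow> (\<lambda>x. \<phi> x \<theta>) \<in> borel_measurable \<mu>"
    and A4_int: "integrable (distr M \<mu> X) G1"
    and A4_bound: "\<And>x \<theta>. x \<in> \<X> \<Longrightarrow> \<theta> \<in> T \<Longrightarrow> \<bar>ln (\<phi> x \<theta>)\<bar> < G1 x"
    and A5_nonneg: "\<And>x. x \<in> \<X> \<Longrightarrow> L x \<ge> 0"
    and A5_int: "integrable \<mu> G2"
    and A5_lipschitz: "\<And>x \<theta>1 \<theta>2. x \<in> \<X> \<Longrightarrow> \<theta>1 \<in> T \<Longrightarrow> \<theta>2 \<in> T \<Longrightarrow>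
          \<bar>\<phi> x \<theta>1 - \<phi> x \<theta>2\<bar> \<le> L x * (\<Sum>j\<in>UNIV. \<bar>(\<theta>1 - \<theta>2) $ j\<bar>)"
    and A5_bound: "\<And>x \<theta>. x \<in> \<X> \<Longrightarrow> \<theta> \<in> T \<Longrightarrow> \<phi> x \<theta> + L x \<le> G2 x"
    and alpha_pos: "\<And>k. k \<ge> 1 \<Longrightarrow> \<alpha> k > 0"
    and alpha_mono: "strict_mono_on {1..} \<alpha>"
    and nu: "\<nu> \<ge> 1"
    and eps: "\<epsilon> > 0"
  shows "((\<lambda>n. measure M {\<omega> \<in> space M. nu_BIC T \<phi> K \<alpha> \<nu> n (\<lambda>i. Xs i \<omega>) = k0}) \<longlonglongrightarrow> 1) \<and>
         ((\<lambda>n. measure M {\<omega> \<in> space M. eps_BIC T \<phi> K \<alpha> \<epsilon> n (\<lambda>i. Xs i \<omega>) = k0}) \<longlonglongrightarrow> 1)"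
proof -
  interpret prob_space M by (rule prob)
  have space: "space \<mu> = \<X>"
    using sets_eq_imp_space_eq[OF base] by (simp add: space_restrict_space)
  have "(\<lambda>x. ennreal (f0 x)) \<in> borel_measurable \<mu>"
    using X_density by (simp add: distributed_def)
  \<comment> \<open>The density is given as an extended nonnegative function; positivity of
    \<open>f0\<close> lets \<open>enn2real\<close> recover the real one.\<close>
  then have "(\<lambda>x. enn2real (ennreal (f0 x))) \<in> borel_measurable \<mu>" by measurable
  moreover have "enn2real (ennreal (f0 x)) = f0 x" if "x \<in> space \<mu>" for x
    using f0_pos[of x] that by (simp add: space)
  ultimately have f0_meas: "f0 \<in> borel_measurable \<mu>"
    by (simp cong: measurable_cong)
  have distr: "distr M \<mu> (Xs i) = density \<mu> (\<lambda>x. ennreal (f0 x))" if "i \<ge> 1" for i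
    using A1_ident[OF that] X_density by (simp add: distributed_def)
  \<comment> \<open>Since \<open>k0 \<ge> 1\<close>, any representation of \<open>f0\<close> as a
    mixture has a first atom, so \<open>T\<close> is nonempty.\<close>
  obtain \<psi> where "\<psi> \<in> mixture_params T k0"
    using A1_f0 by (auto simp: mixture_class_def)
  then have "snd \<psi> 1 \<in> T"
    by (rule mixture_params_D(2)) (use A1_order in simp)
  then have T: "T \<noteq> {}" by blast
  interpret iid_mixture M \<mu> f0 Xs T \<phi> L G2
  proof (unfold_locales, unfold space)
  qed (fact f0_meas f0_pos A1_indep distr A2_compact T A2_pos A3_cont phi_density
      A5_nonneg A5_int A5_lipschitz A5_bound)+
  have f0: "f0 \<in> mixture_class \<mu> T \<phi> k0" "f0 \<notin> mixture_class \<mu> T \<phi> (k0 - 1)"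
    using A1_f0 by auto
  show ?thesis
    unfolding nu_BIC_def eps_BIC_def
    by (intro conjI order_estimator_consistent[OF A1_order f0 alpha_mono] nu_BIC_rate nu eps_BIC_rate eps)
qed

end
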